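(* Let $\mathbf{S}$ be a canonical single-parameter exponential family with divergence $d(\cdot,\cdot)$, and let $\pi_1$ be the KL-based confidence-interval policy with threshold $\beta(\delta)=\log(2/\delta)$. Then, for every $\nu\in\mathbf{S}$ with mean $\mu$ and every $N_\delta\to\infty$ (as $\delta\to0$) for which $\lim_{\delta\to0}N_\delta/\log(1/\delta)$ exists in $[0,\infty]$: (a) $\pi_1\in\Pi^s_{\rm CI}$. (b) If $\lim_{\delta\to0}\frac{N_\delta}{\log(1/\delta)}=k$ with $k\in(0,\infty)$, then the limiting endpoints of $\pi_1$ are $\mu_R^{\pi_1}(\mu)=\mu_R^*(\mu,k)$ and $\mu_L^{\pi_1}(\mu)=\mu_L^*(\mu,k)$, where $\mu_L^*(\mu,k)<\mu$ and $\mu_R^*(\mu,k)>\mu$ uniquely solve $d(\mu,\mu_R^*(\mu,k))=d(\mu,\mu_L^*(\mu,k))=\frac1k$. (c) If $\lim_{\delta\to0}\frac{N_\delta}{\log(1/\delta)}=\infty$, then $\mu_R^{\pi_1}(\mu)-\mu_L^{\pi_1}(\mu)=0$.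
   Context: Exponential family. Fix a reference measure $\xi$ on $\mathbb{R}$. $\mathbf{S}=\{p_\theta:\theta\in\Theta\}$, with $\frac{dp_\theta}{d\xi}(x)=\exp(\theta x-b(\theta))$, where $\Theta=\{\theta\in\mathbb{R}:\int|x|e^{\theta x}\,d\xi(x)<\infty\}$ is assumed to be an open interval, and $b$ is a twice differentiable, strictly convex function. The mean of $p_\theta$ is $b'(\theta)$, strictly increasing in $\theta$; its inverse is $\mu\mapsto\theta(\mu)$. The set of means is the open interval $\mathbf{O}=(\underline\mu,\overline\mu)$ (endpoints possibly infinite). For $\mu,\tilde\mu\in\mathbf{O}$, $d(\mu,\tilde\mu)=KL(p_{\theta(\mu)},p_{\theta(\tilde\mu)})=b(\theta(\tilde\mu))-b(\theta(\mu))-b'(\theta(\mu))(\theta(\tilde\mu)-\theta(\mu))$. Equivalently $d(y,q)=\sup_{\lambda\in\mathbb{R}}\{\lambda y-\log\mathbb{E}_{p_{\theta(q)}}[e^{\lambda X}]\}$, and this formula defines $d(y,q)\in[0,\infty]$ for $q\in\mathbf{O}$ when $y\notin\mathbf{O}$. Policies. $X_1,X_2,\dots$ are i.i.d. from $\nu$; $\mathbb{P}_\nu$ is the corresponding probability. A policy $\pi$ assigns to each $n\in\mathbb{N}$ and $\delta\in(0,1)$ an interval $[\widehat\mu_L^\pi(n,\delta),\widehat\mu_R^\pi(n,\delta)]$ whose (extended-real) endpoints are measurable functions of $X_1,\dots,X_n$. $\Pi_{\rm CI}$ is the set of policies such that for every $\nu\in\mathbf{S}$ with mean $\mu$, every $\delta\in(0,1)$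 and every $n\in\mathbb{N}$, $\mathbb{P}_\nu(\mu\in[\widehat\mu_L^\pi(n,\delta),\widehat\mu_R^\pi(n,\delta)])\ge1-\delta$. Stability. $N_\delta$ is a positive-integer-valued function of $\delta\in(0,1)$. A policy $\pi\in\Pi_{\rm CI}$ is stable (for $\nu$ with mean $\mu$ and $N_\delta$) if, as $\delta\to0$, under $\mathbb{P}_\nu$, $\widehat\mu_L^\pi(N_\delta,\delta)\overset{p}{\to}\mu_L^\pi(\mu)$ and $\widehat\mu_R^\pi(N_\delta,\delta)\overset{p}{\to}\mu_R^\pi(\mu)$, where $\mu_L^\pi(\mu)\le\mu\le\mu_R^\pi(\mu)$ are deterministic constants ($\pm\infty$ allowed), called the limiting endpoints. $\Pi^s_{\rm CI}$ is the set of stable policies in $\Pi_{\rm CI}$. Policy $\pi_1$. With $\hat\mu_n=\frac1n\sum_{t=1}^nX_t$ and $\beta(\delta)=\log(2/\delta)$, $\widehat\mu_R^{\pi_1}(n,\delta)=\sup\{q\in\mathbf{O}:q>\hat\mu_n,\ n\,d(\hat\mu_n,q)\le\beta(\delta)\}$ and $\widehat\mu_L^{\pi_1}(n,\delta)=\inf\{q\in\mathbf{O}:q<\hat\mu_n,\ n\,d(\hat\mu_n,q)\le\beta(\delta)\}$, each taken to be $\hat\mu_n$ if the corresponding set is empty.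
   Formalization: In (b), each side's claim assumes that d(μ,q) ≥ 1/k for some mean q on that side; otherwise no solution exists (e.g. ξ with density e^{-x}/x² on [1,∞), small k). It is proved automatic if Θ contains every θ with ∫e^{θx}dξ < ∞. *)

theory Defs
  imports "HOL-Probability.Probability"
begin

definition Theta :: "real measure \<Rightarrow> real set" where
  "Theta \<xi> = {\<theta>. integrable \<xi> (\<lambda>x. \<bar>x\<bar> * exp (\<theta> * x))}"

definition family_member :: "real measure \<Rightarrow> (real \<Rightarrow> real) \<Rightarrow> real \<Rightarrow> real measure" where
  "family_member \<xi> b \<theta> = density \<xi> (\<lambda>x. ennreal (exp (\<theta> * x - b \<theta>)))"

definition family :: "real measure \<Rightarrow> (real \<Rightarrow> real) \<Rightarrow> real measure set" where
  "family \<xi> b = family_member \<xi> b ` Theta \<xi>"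

definition strictly_convex_on :: "real set \<Rightarrow> (real \<Rightarrow> real) \<Rightarrow> bool" where
  "strictly_convex_on S f \<longleftrightarrow>
     (\<forall>x\<in>S. \<forall>y\<in>S. \<forall>t\<in>{0<..<1}. x \<noteq> y \<longrightarrow>
        f ((1 - t) * x + t * y) < (1 - t) * f x + t * f y)"

text \<open>The normalisation of the densities forces
  \<open>b \<theta> = ln (\<integral>x. exp (\<theta> * x) \<partial>\<xi>)\<close> on \<open>Theta \<xi>\<close>; outside \<open>Theta \<xi>\<close> the values of \<open>b\<close> are
  irrelevant.\<close>

locale exp_family =
  fixes \<xi> :: "real measure" and b :: "real \<Rightarrow> real"
  assumes sets_ref: "sets \<xi> = sets borel"
    and open_Theta: "open (Theta \<xi>)"
    and interval_Theta: "is_interval (Theta \<xi>)"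
    and nonempty_Theta: "Theta \<xi> \<noteq> {}"
    and normalised: "\<And>\<theta>. \<theta> \<in> Theta \<xi> \<Longrightarrow> prob_space (family_member \<xi> b \<theta>)"
    and differentiable_b: "\<And>\<theta>. \<theta> \<in> Theta \<xi> \<Longrightarrow> b differentiable (at \<theta>)"
    and twice_differentiable_b: "\<And>\<theta>. \<theta> \<in> Theta \<xi> \<Longrightarrow> deriv b differentiable (at \<theta>)"
    and strictly_convex_b: "strictly_convex_on (Theta \<xi>) b"

definition mean :: "real measure \<Rightarrow> real" where
  "mean \<nu> = (\<integral>x. x \<partial>\<nu>)"

definition means :: "real measure \<Rightarrow> (real \<Rightarrow> real) \<Rightarrow> real set" where
  "means \<xi> b = mean ` family \<xi> b"

definition theta_of :: "real measure \<Rightarrow> (real \<Rightarrow> real) \<Rightarrow> real \<Rightarrow> real" where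
  "theta_of \<xi> b = the_inv_into (Theta \<xi>) (\<lambda>\<theta>. mean (family_member \<xi> b \<theta>))"

definition member_with_mean :: "real measure \<Rightarrow> (real \<Rightarrow> real) \<Rightarrow> real \<Rightarrow> real measure" where
  "member_with_mean \<xi> b m = family_member \<xi> b (theta_of \<xi> b m)"

definition log_mgf :: "real measure \<Rightarrow> real \<Rightarrow> ereal" where
  "log_mgf \<nu> l =
     (if integrable \<nu> (\<lambda>x. exp (l * x)) then ereal (ln (\<integral>x. exp (l * x) \<partial>\<nu>)) else \<infinity>)"

text \<open>In \<open>KL_divergence c M N\<close> the expectation is taken under the last argument, so it is the
  divergence usually written KL(N, M), here with natural logarithms. For \<open>y\<close> outside the set of
  means (where the empirical mean may well lie) the divergence is the Legendre-type supremum,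
  which may be infinite.\<close>

definition divergence :: "real measure \<Rightarrow> (real \<Rightarrow> real) \<Rightarrow> real \<Rightarrow> real \<Rightarrow> ereal" where
  "divergence \<xi> b y q =
     (if y \<in> means \<xi> b
      then ereal (KL_divergence (exp 1) (member_with_mean \<xi> b q) (member_with_mean \<xi> b y))
      else (SUP l. ereal (l * y) - log_mgf (member_with_mean \<xi> b q) l))"

text \<open>The sample space of an i.i.d. sequence \<open>X\<^sub>1, X\<^sub>2, \<dots>\<close> with law \<open>\<nu>\<close>; \<open>X\<^sub>t\<close> is the \<open>t\<close>-th
  coordinate.\<close>

definition iid :: "real measure \<Rightarrow> (nat \<Rightarrow> real) measure" where
  "iid \<nu> = (\<Pi>\<^sub>M t\<in>{1..}. \<nu>)"

text \<open>The endpoints for sample size \<open>n\<close> and level \<open>\<delta>\<close> are functions of the sample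
  \<open>(X\<^sub>1, \<dots>, X\<^sub>n)\<close>, encoded as a function on \<open>{1..n}\<close>.\<close>

record ci_policy =
  lower :: "nat \<Rightarrow> real \<Rightarrow> (nat \<Rightarrow> real) \<Rightarrow> ereal"
  upper :: "nat \<Rightarrow> real \<Rightarrow> (nat \<Rightarrow> real) \<Rightarrow> ereal"

definition is_policy :: "ci_policy \<Rightarrow> bool" where
  "is_policy \<pi> \<longleftrightarrow>
     (\<forall>n\<ge>1. \<forall>\<delta>\<in>{0<..<1}.
        lower \<pi> n \<delta> \<in> borel_measurable (\<Pi>\<^sub>M t\<in>{1..n}. borel) \<and>
        upper \<pi> n \<delta> \<in> borel_measurable (\<Pi>\<^sub>M t\<in>{1..n}. borel) \<and>
        (\<forall>x\<in>space (\<Pi>\<^sub>M t\<in>{1..n}. borel). lower \<pi> n \<delta> x \<le> upper \<pi> n \<delta> x))"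

definition lower_at :: "ci_policy \<Rightarrow> nat \<Rightarrow> real \<Rightarrow> (nat \<Rightarrow> real) \<Rightarrow> ereal" where
  "lower_at \<pi> n \<delta> \<omega> = lower \<pi> n \<delta> (restrict \<omega> {1..n})"

definition upper_at :: "ci_policy \<Rightarrow> nat \<Rightarrow> real \<Rightarrow> (nat \<Rightarrow> real) \<Rightarrow> ereal" where
  "upper_at \<pi> n \<delta> \<omega> = upper \<pi> n \<delta> (restrict \<omega> {1..n})"

definition CI_policies :: "real measure \<Rightarrow> (real \<Rightarrow> real) \<Rightarrow> ci_policy set" where
  "CI_policies \<xi> b =
     {\<pi>. is_policy \<pi> \<and>
        (\<forall>\<nu>\<in>family \<xi> b. \<forall>\<delta>\<in>{0<..<1}. \<forall>n\<ge>1.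
           measure (iid \<nu>)
             {\<omega> \<in> space (iid \<nu>). ereal (mean \<nu>) \<in> {lower_at \<pi> n \<delta> \<omega> .. upper_at \<pi> n \<delta> \<omega>}}
           \<ge> 1 - \<delta>)}"

text \<open>Convergence in probability to a constant as \<open>\<delta>\<close> decreases to 0, phrased with open
  neighbourhoods so that it covers the limits \<open>\<plusminus>\<infinity>\<close> as well; at a finite limit it is the usual
  \<open>\<epsilon>\<close>-condition.\<close>

definition converges_in_prob :: "'a measure \<Rightarrow> (real \<Rightarrow> 'a \<Rightarrow> ereal) \<Rightarrow> ereal \<Rightarrow> bool" where
  "converges_in_prob P Z c \<longleftrightarrow>
     (\<forall>U. open U \<and> c \<in> U \<longrightarrow>
        ((\<lambda>\<delta>. measure P {\<omega> \<in> space P. Z \<delta> \<omega> \<notin> U}) \<longlongrightarrow> 0) (at_right 0))"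

definition limiting_endpoints ::
    "ci_policy \<Rightarrow> real measure \<Rightarrow> (real \<Rightarrow> nat) \<Rightarrow> ereal \<Rightarrow> ereal \<Rightarrow> bool" where
  "limiting_endpoints \<pi> \<nu> N mL mR \<longleftrightarrow>
     mL \<le> ereal (mean \<nu>) \<and> ereal (mean \<nu>) \<le> mR \<and>
     converges_in_prob (iid \<nu>) (\<lambda>\<delta>. lower_at \<pi> (N \<delta>) \<delta>) mL \<and>
     converges_in_prob (iid \<nu>) (\<lambda>\<delta>. upper_at \<pi> (N \<delta>) \<delta>) mR"

definition stable_CI_policies ::
    "real measure \<Rightarrow> (real \<Rightarrow> real) \<Rightarrow> real measure \<Rightarrow> (real \<Rightarrow> nat) \<Rightarrow> ci_policy set" where
  "stable_CI_policies \<xi> b \<nu> N =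
     {\<pi> \<in> CI_policies \<xi> b. \<exists>mL mR. limiting_endpoints \<pi> \<nu> N mL mR}"

definition emp_mean :: "nat \<Rightarrow> (nat \<Rightarrow> real) \<Rightarrow> real" where
  "emp_mean n x = (\<Sum>t=1..n. x t) / real n"

definition threshold :: "real \<Rightarrow> real" where
  "threshold \<delta> = ln (2 / \<delta>)"

definition upper_candidates ::
    "real measure \<Rightarrow> (real \<Rightarrow> real) \<Rightarrow> nat \<Rightarrow> real \<Rightarrow> real \<Rightarrow> real set" where
  "upper_candidates \<xi> b n \<delta> y =
     {q \<in> means \<xi> b. y < q \<and> ereal (real n) * divergence \<xi> b y q \<le> ereal (threshold \<delta>)}"

definition lower_candidates ::
    "real measure \<Rightarrow> (real \<Rightarrow> real) \<Rightarrow> nat \<Rightarrow> real \<Rightarrow> real \<Rightarrow> real set" where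
  "lower_candidates \<xi> b n \<delta> y =
     {q \<in> means \<xi> b. q < y \<and> ereal (real n) * divergence \<xi> b y q \<le> ereal (threshold \<delta>)}"

definition pi1 :: "real measure \<Rightarrow> (real \<Rightarrow> real) \<Rightarrow> ci_policy" where
  "pi1 \<xi> b =
     \<lparr> lower = (\<lambda>n \<delta> x. let y = emp_mean n x; C = lower_candidates \<xi> b n \<delta> y in
         if C = {} then ereal y else (INF q\<in>C. ereal q)),
       upper = (\<lambda>n \<delta> x. let y = emp_mean n x; C = upper_candidates \<xi> b n \<delta> y in
         if C = {} then ereal y else (SUP q\<in>C. ereal q)) \<rparr>"

definition right_solution ::
    "real measure \<Rightarrow> (real \<Rightarrow> real) \<Rightarrow> real \<Rightarrow> real \<Rightarrow> real \<Rightarrow> bool" where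
  "right_solution \<xi> b m k q \<longleftrightarrow>
     q \<in> means \<xi> b \<and> m < q \<and> divergence \<xi> b m q = ereal (1 / k)"

definition left_solution ::
    "real measure \<Rightarrow> (real \<Rightarrow> real) \<Rightarrow> real \<Rightarrow> real \<Rightarrow> real \<Rightarrow> bool" where
  "left_solution \<xi> b m k q \<longleftrightarrow>
     q \<in> means \<xi> b \<and> q < m \<and> divergence \<xi> b m q = ereal (1 / k)"

text \<open>The divergence from \<open>m\<close> reaches the level \<open>1 / k\<close> on the given side. This can fail, for
  large \<open>1 / k\<close>, when the moment generating function is finite at a finite endpoint of
  \<open>Theta \<xi>\<close>: for \<open>\<xi>\<close> with density \<open>exp (- x) / x\<^sup>2\<close> on \<open>[1, \<infinity>)\<close>, \<open>Theta \<xi> = {..<1}\<close> while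
  \<open>b\<close> stays bounded at 1, so the divergence from \<open>m\<close> is bounded on the right of \<open>m\<close>.\<close>

definition reaches_right ::
    "real measure \<Rightarrow> (real \<Rightarrow> real) \<Rightarrow> real \<Rightarrow> real \<Rightarrow> bool" where
  "reaches_right \<xi> b m k \<longleftrightarrow> (\<exists>q\<in>means \<xi> b. m < q \<and> ereal (1 / k) \<le> divergence \<xi> b m q)"

definition reaches_left ::
    "real measure \<Rightarrow> (real \<Rightarrow> real) \<Rightarrow> real \<Rightarrow> real \<Rightarrow> bool" where
  "reaches_left \<xi> b m k \<longleftrightarrow> (\<exists>q\<in>means \<xi> b. q < m \<and> ereal (1 / k) \<le> divergence \<xi> b m q)"

text \<open>\<open>Theta \<xi>\<close> is the whole natural parameter space. Then both levels are always reached.\<close>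

definition full_family :: "real measure \<Rightarrow> bool" where
  "full_family \<xi> \<longleftrightarrow> {\<theta>. integrable \<xi> (\<lambda>x. exp (\<theta> * x))} = Theta \<xi>"

end

theory Submission
  imports Defs
begin

text \<open>
  Fix a member \<open>p\<close> of the family, with mean \<open>m\<close>. For a sample of size \<open>n\<close> with empirical mean \<open>y\<close>,
  the right endpoint of the interval is \<open>U c y\<close>, the supremum of \<open>y\<close> and of all means \<open>q > y\<close> with
  \<open>d y q \<le> c\<close>, where \<open>c = ln (2 / \<delta>) / n\<close>. Everything rests on the shape of \<open>d\<close>: it does
  not increase when its first argument moves towards the second; from a first argument that is
  itself a mean, it strictly increases when the second moves away; and it is continuous in
  each argument on the set of means. Locale \<open>divergence_function\<close> collects these properties. They are invariant under reflection of the
  real line, and reflection turns left endpoints into right endpoints; so only right endpoints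
  are studied.

  For the coverage, note that the mean \<open>m\<close> lies to the right of \<open>U c y\<close> only if \<open>y < m\<close> and \<open>d y m > c\<close>. As
  \<open>d y m\<close> is the exponent in Chernoff's bound, each such \<open>y\<close> bounds the empirical mean from above
  with probability at most \<open>exp (- n * c) = \<delta> / 2\<close>. These \<open>y\<close> form a down-closed set, so by
  continuity from below the whole set has probability at most \<open>\<delta> / 2\<close> as well
  (\<open>prob_upper_end_less\<close>); the two sides add up to \<open>\<delta>\<close> (\<open>coverage_pi1\<close>).

  For the limits, note that \<open>U c\<close> is monotone, and that \<open>U c' y\<close> comes close to \<open>U c m\<close> as \<open>c'\<close> tends to \<open>c\<close> and \<open>y\<close>
  to \<open>m\<close> from the appropriate side (\<open>eventually_less_upper_end\<close>, \<open>eventually_upper_end_less\<close>).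
  Chernoff's bound gives the weak law of large numbers, and \<open>ln (2 / \<delta>) / N \<delta>\<close> tends to \<open>1 / K\<close>
  in \<open>[0, \<infinity>]\<close> when \<open>N \<delta> / ln (1 / \<delta>)\<close> tends to \<open>K\<close>. Hence the right endpoint converges in
  probability to \<open>U (1 / K) m\<close> (\<open>limiting_endpoints_pi1\<close>), and the limit is unique. For
  \<open>K = \<infinity>\<close> it is \<open>m\<close>, since \<open>d m q > 0\<close> for \<open>q \<noteq> m\<close>. For \<open>0 < K < \<infinity>\<close> it is the solution of
  \<open>d m q = 1 / K\<close> when the level \<open>1 / K\<close> is reached, which exists by the intermediate value theorem.

  The exponential family enters as follows. Jensen's inequality makes the mean of \<open>p\<^sub>\<theta>\<close> a subgradient of \<open>b\<close> at
  \<open>\<theta>\<close>, so the mean is \<open>b' \<theta>\<close> and the divergence is the Bregman divergence of \<open>b\<close>. The same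
  inequality shows that it agrees with the Legendre-type supremum, so that the supremum formula
  holds for every real first argument (\<open>divergence_eq_SUP\<close>). In a full family the divergence is
  unbounded on both sides: otherwise the parameters on one side would run up to a finite
  boundary point near which \<open>b\<close> stays bounded, and Fatou's lemma would put that point into
  the open parameter set (\<open>bregman_unbounded\<close>).
\<close>

section \<open>Endpoints of divergence balls\<close>

text \<open>Inserting \<open>y\<close> itself accounts for the convention that the endpoint is \<open>y\<close> when no point of \<open>A\<close>
  qualifies. The threshold is an extended real so that \<open>0\<close> and \<open>\<infinity>\<close> may serve as limits of
  thresholds, and the limiting endpoint is an instance of the same function.\<close>
definition upper_end :: "real set \<Rightarrow> (real \<Rightarrow> real \<Rightarrow> ereal) \<Rightarrow> ereal \<Rightarrow> real \<Rightarrow> ereal" where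
  "upper_end A d c y = (SUP q\<in>insert y {q \<in> A. y < q \<and> d y q \<le> c}. ereal q)"

definition lower_end :: "real set \<Rightarrow> (real \<Rightarrow> real \<Rightarrow> ereal) \<Rightarrow> ereal \<Rightarrow> real \<Rightarrow> ereal" where
  "lower_end A d c y = (INF q\<in>insert y {q \<in> A. q < y \<and> d y q \<le> c}. ereal q)"

abbreviation reflect :: "(real \<Rightarrow> real \<Rightarrow> ereal) \<Rightarrow> real \<Rightarrow> real \<Rightarrow> ereal" where
  "reflect d \<equiv> \<lambda>y q. d (- y) (- q)"

lemma lower_end_eq_reflected_upper_end:
  "lower_end A d c y = - upper_end (uminus ` A) (reflect d) c (- y)"
proof -
  have "insert (- y) {q \<in> uminus ` A. - y < q \<and> d (- (- y)) (- q) \<le> c}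
      = uminus ` insert y {q \<in> A. q < y \<and> d y q \<le> c}"
    by auto
  then have "upper_end (uminus ` A) (reflect d) c (- y)
      = (SUP q\<in>insert y {q \<in> A. q < y \<and> d y q \<le> c}. - ereal q)"
    by (simp add: upper_end_def image_image)
  also have "\<dots> = - lower_end A d c y"
    unfolding lower_end_def by (rule ereal_SUP_uminus_eq)
  finally show ?thesis by simp
qed

lemma upper_end_ge: "ereal y \<le> upper_end A d c y"
  unfolding upper_end_def by (rule SUP_upper) simp

lemma lower_end_le: "lower_end A d c y \<le> ereal y"
  unfolding lower_end_def by (rule INF_lower) simp

lemma upper_end_less_imp:
  assumes "m \<in> A" "upper_end A d c y < ereal m"
  shows "y < m" "c < d y m"
proof -
  show "y < m"
    using order_le_less_trans[OF upper_end_ge assms(2)] by simp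
  show "c < d y m"
  proof (rule ccontr)
    assume "\<not> c < d y m"
    with \<open>y < m\<close> \<open>m \<in> A\<close> have "ereal m \<le> upper_end A d c y"
      unfolding upper_end_def by (intro SUP_upper) auto
    with assms(2) show False by simp
  qed
qed

lemma borel_measurable_mono_ereal:
  fixes f :: "real \<Rightarrow> ereal"
  assumes "mono f"
  shows "f \<in> borel_measurable borel"
  unfolding borel_measurable_ereal_iff_Iio
proof
  fix a
  have "f x < a" if "x \<le> y" "f y < a" for x y
    using monoD[OF assms that(1)] that(2) by (rule order_le_less_trans)
  then have "is_interval (f -` {..<a})"
    unfolding is_interval_1 by blast
  then show "f -` {..<a} \<inter> space borel \<in> sets borel"
    by (simp add: real_interval_borel_measurable)
qed

text \<open>The first argument ranges over all reals, because the empirical mean need not belong to the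
  set \<open>A\<close> of admissible means; strictness in the second argument and continuity in the first hold
  in general only where the first argument is itself in \<open>A\<close>, since the divergence may be infinite
  elsewhere.\<close>
locale divergence_function =
  fixes A :: "real set" and d :: "real \<Rightarrow> real \<Rightarrow> ereal"
  assumes open_A: "open A" and interval_A: "is_interval A"
    and diag: "q \<in> A \<Longrightarrow> d q q = 0"
    and antimono_fst: "q \<in> A \<Longrightarrow> y1 \<le> y2 \<Longrightarrow> y2 \<le> q \<Longrightarrow> d y2 q \<le> d y1 q"
    and mono_fst: "q \<in> A \<Longrightarrow> q \<le> y1 \<Longrightarrow> y1 \<le> y2 \<Longrightarrow> d y1 q \<le> d y2 q"
    and strict_mono_snd:
      "y \<in> A \<Longrightarrow> q1 \<in> A \<Longrightarrow> q2 \<in> A \<Longrightarrow> y \<le> q1 \<Longrightarrow> q1 < q2 \<Longrightarrow> d y q1 < d y q2"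
    and strict_antimono_snd:
      "y \<in> A \<Longrightarrow> q1 \<in> A \<Longrightarrow> q2 \<in> A \<Longrightarrow> q1 < q2 \<Longrightarrow> q2 \<le> y \<Longrightarrow> d y q2 < d y q1"
    and continuous_fst: "q \<in> A \<Longrightarrow> continuous_on A (\<lambda>y. d y q)"
    and continuous_snd: "y \<in> A \<Longrightarrow> continuous_on A (\<lambda>q. d y q)"

context divergence_function
begin

lemma divergence_function_reflect: "divergence_function (uminus ` A) (reflect d)"
proof
  show "open (uminus ` A)"
    using open_A by (rule open_negations)
  show "is_interval (uminus ` A)"
    using interval_A by simp
  show "continuous_on (uminus ` A) (\<lambda>y. d (- y) (- q))" if "q \<in> uminus ` A" for q
    using that by (intro continuous_on_compose2[OF continuous_fst[of "- q"]] continuous_intros) auto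
  show "continuous_on (uminus ` A) (\<lambda>q. d (- y) (- q))" if "y \<in> uminus ` A" for y
    using that by (intro continuous_on_compose2[OF continuous_snd[of "- y"]] continuous_intros) auto
qed (auto simp: diag antimono_fst mono_fst strict_mono_snd strict_antimono_snd)

lemma mem_A_between: "p \<in> A \<Longrightarrow> r \<in> A \<Longrightarrow> p \<le> q \<Longrightarrow> q \<le> r \<Longrightarrow> q \<in> A"
  using interval_A unfolding is_interval_1 by blast

text \<open>A candidate for \<open>y1\<close> is either already passed by \<open>y2\<close> or remains a candidate for it, because
  \<open>y2\<close> is closer to it.\<close>
lemma upper_end_mono: "mono (upper_end A d c)"
proof (rule monoI)
  fix y1 y2 :: real assume le: "y1 \<le> y2"
  show "upper_end A d c y1 \<le> upper_end A d c y2"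
    unfolding upper_end_def[of A d c y1]
  proof (rule SUP_least)
    fix q assume q: "q \<in> insert y1 {q \<in> A. y1 < q \<and> d y1 q \<le> c}"
    show "ereal q \<le> upper_end A d c y2"
    proof (cases "q \<le> y2")
      case True
      then show ?thesis using upper_end_ge[of y2 A d c] by (meson ereal_less_eq(3) order_trans)
    next
      case False
      with q le have "q \<in> A" "d y1 q \<le> c" by auto
      moreover have "d y2 q \<le> d y1 q"
        using False le \<open>q \<in> A\<close> by (intro antimono_fst) auto
      ultimately show ?thesis
        unfolding upper_end_def using False by (intro SUP_upper) auto
    qed
  qed
qed

lemma upper_end_measurable: "upper_end A d c \<in> borel_measurable borel"
  by (rule borel_measurable_mono_ereal[OF upper_end_mono])

lemma lower_end_measurable: "lower_end A d c \<in> borel_measurable borel"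
proof -
  interpret R: divergence_function "uminus ` A" "reflect d" by (rule divergence_function_reflect)
  note [measurable] = R.upper_end_measurable
  show ?thesis unfolding lower_end_eq_reflected_upper_end[abs_def] by measurable
qed

lemma tendsto_fst:
  assumes "m \<in> A" "q \<in> A"
  shows "((\<lambda>y. d y q) \<longlongrightarrow> d m q) (at m within S)"
proof -
  have "isCont (\<lambda>y. d y q) m"
    using continuous_fst[OF assms(2)] open_A assms(1) by (simp add: continuous_on_eq_continuous_at)
  then show ?thesis unfolding isCont_def by (rule tendsto_within_subset) simp
qed

text \<open>Half of the joint continuity of the endpoint at \<open>(c, m)\<close>. For \<open>a < m\<close> it suffices that the endpoint
  is at least the centre. Otherwise a candidate \<open>q'\<close> strictly between \<open>a\<close>
  and a candidate \<open>q\<close> has divergence strictly below \<open>c\<close> from \<open>m\<close>. This slack absorbs small changes of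
  both the threshold and the centre. Monotonicity in the centre extends the bound from the
  single \<open>y\<close> provided here to every larger centre.\<close>
lemma eventually_less_upper_end:
  assumes m: "m \<in> A" and lt: "a < upper_end A d c m" and lim: "(c' \<longlongrightarrow> c) F"
  shows "\<exists>y<m. \<forall>\<^sub>F i in F. a < upper_end A d (c' i) y"
proof (cases "a < ereal m")
  case True
  then obtain y where y: "a < ereal y" "ereal y < ereal m" using ereal_dense2 by blast
  have "a < upper_end A d (c' i) y" for i
    using order_less_le_trans[OF y(1) upper_end_ge] .
  with y show ?thesis by auto
next
  case False
  from lt False obtain q where q: "q \<in> A" "m < q" "d m q \<le> c" "a < ereal q"
    unfolding upper_end_def less_SUP_iff by auto
  obtain q' where q': "max a (ereal m) < ereal q'" "ereal q' < ereal q"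
    using ereal_dense2[of "max a (ereal m)" "ereal q"] q by auto
  then have q'2: "m < q'" "q' < q" "a < ereal q'" by auto
  then have q'A: "q' \<in> A" using mem_A_between[OF m q(1), of q'] by auto
  have "d m q' < d m q" using strict_mono_snd[OF m q'A q(1)] q'2 by auto
  with q(3) have "d m q' < c" by simp
  then obtain e where e: "d m q' < e" "e < c" using dense by blast
  have "\<forall>\<^sub>F y in at_left m. d y q' < e"
    by (rule order_tendstoD(2)[OF tendsto_fst[OF m q'A] e(1)])
  moreover have "\<forall>\<^sub>F y in at_left m. y < m"
    by (simp add: eventually_at_filter)
  ultimately have "\<forall>\<^sub>F y in at_left m. d y q' < e \<and> y < m"
    by eventually_elim auto
  then obtain y where y: "d y q' < e" "y < m"
    using eventually_happens' trivial_limit_at_left_real by blast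
  have "\<forall>\<^sub>F i in F. a < upper_end A d (c' i) y"
    using order_tendstoD(1)[OF lim e(2)]
  proof eventually_elim
    case (elim i)
    have "ereal q' \<le> upper_end A d (c' i) y"
      unfolding upper_end_def using y q'A q'2 elim by (intro SUP_upper) auto
    with q'2(3) show ?case by simp
  qed
  with y show ?thesis by auto
qed

text \<open>The other half: a mean \<open>r\<close> beyond the endpoint has divergence strictly above \<open>c\<close> from \<open>m\<close>, and still
  so from nearby centres; no point beyond \<open>r\<close> can then be a candidate. If \<open>r\<close> lies outside \<open>A\<close>,
  all of \<open>A\<close> stays to its left.\<close>
lemma eventually_upper_end_less:
  assumes m: "m \<in> A" and lt: "upper_end A d c m < a" and lim: "(c' \<longlongrightarrow> c) F"
  shows "\<exists>y>m. \<forall>\<^sub>F i in F. upper_end A d (c' i) y < a"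
proof -
  obtain r where r: "upper_end A d c m < ereal r" "ereal r < a" using ereal_dense2[OF lt] by blast
  have mr: "m < r" using order_le_less_trans[OF upper_end_ge r(1)] by simp
  have "\<exists>y>m. \<forall>\<^sub>F i in F. upper_end A d (c' i) y \<le> ereal r"
  proof (cases "r \<in> A")
    case True
    have "c < d m r" by (rule upper_end_less_imp[OF True r(1)])
    then obtain e where e: "c < e" "e < d m r" using dense by blast
    have "\<forall>\<^sub>F y in at_right m. e < d y r"
      by (rule order_tendstoD(1)[OF tendsto_fst[OF m True] e(2)])
    moreover have "\<forall>\<^sub>F y in at_right m. m < y \<and> y < r"
      using eventually_at_right_real[OF mr] by simp
    ultimately have "\<forall>\<^sub>F y in at_right m. e < d y r \<and> m < y \<and> y < r"
      by eventually_elim auto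
    then obtain y where y: "e < d y r" "m < y" "y < r"
      using eventually_happens' trivial_limit_at_right_real by blast
    have yA: "y \<in> A" using mem_A_between[OF m True] y by auto
    have "\<forall>\<^sub>F i in F. upper_end A d (c' i) y \<le> ereal r"
      using order_tendstoD(2)[OF lim e(1)]
    proof eventually_elim
      case (elim i)
      have "q \<le> r" if "q \<in> A" "d y q \<le> c' i" for q
      proof (rule ccontr)
        assume "\<not> q \<le> r"
        then have "d y r < d y q" using strict_mono_snd[OF yA True that(1)] y by auto
        with that(2) elim y(1) show False by (meson leD less_le_trans order.strict_trans)
      qed
      then show ?case
        unfolding upper_end_def using y by (intro SUP_least) auto
    qed
    with y show ?thesis by blast
  next
    case False
    obtain y where y: "m < y" "y < r" using dense[OF mr] by blast
    have "q \<le> r" if "q \<in> A" for q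
      using False mem_A_between[OF m that, of r] mr by force
    then have "upper_end A d (c' i) y \<le> ereal r" for i
      unfolding upper_end_def using y by (intro SUP_least) auto
    with y show ?thesis by auto
  qed
  then obtain y where y: "m < y" "\<forall>\<^sub>F i in F. upper_end A d (c' i) y \<le> ereal r" by blast
  from y(2) have "\<forall>\<^sub>F i in F. upper_end A d (c' i) y < a"
    by eventually_elim (rule order_le_less_trans[OF _ r(2)])
  with y(1) show ?thesis by blast
qed

lemma upper_end_at_solution:
  assumes m: "m \<in> A" and r: "r \<in> A" "m < r" "d m r = c"
  shows "upper_end A d c m = ereal r"
proof (rule antisym)
  have "q \<le> r" if "q \<in> A" "d m q \<le> c" for q
    using strict_mono_snd[OF m r(1) that(1)] r that(2) by force
  then show "upper_end A d c m \<le> ereal r"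
    unfolding upper_end_def using r by (intro SUP_least) auto
  show "ereal r \<le> upper_end A d c m"
    unfolding upper_end_def using r by (intro SUP_upper) auto
qed

lemma upper_end_zero:
  assumes m: "m \<in> A"
  shows "upper_end A d 0 m = ereal m"
proof -
  have "{q \<in> A. m < q \<and> d m q \<le> 0} = {}"
    using strict_mono_snd[OF m m] diag[OF m] by force
  then have "upper_end A d 0 m = (SUP q\<in>{m}. ereal q)"
    unfolding upper_end_def by (simp only:)
  then show ?thesis by simp
qed

lemma ex1_right_level:
  assumes m: "m \<in> A" and q: "q \<in> A" "m < q" "c \<le> d m q" and c: "0 < c"
  shows "\<exists>!r. r \<in> A \<and> m < r \<and> d m r = c"
proof (rule ex_ex1I)
  have "continuous_on {m..q} (d m)"
    using mem_A_between[OF m q(1)] by (intro continuous_on_subset[OF continuous_snd[OF m]]) auto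
  then obtain r where r: "m \<le> r" "r \<le> q" "d m r = c"
    using IVT'[of "d m" m c q] q c diag[OF m] by (auto simp: less_imp_le)
  with c diag[OF m] have "m < r" by (cases "r = m") auto
  with r m q(1) show "\<exists>r. r \<in> A \<and> m < r \<and> d m r = c" using mem_A_between by blast
next
  fix r s assume "r \<in> A \<and> m < r \<and> d m r = c" "s \<in> A \<and> m < s \<and> d m s = c"
  then show "r = s"
    using strict_mono_snd[OF m, of r s] strict_mono_snd[OF m, of s r]
    by (cases r s rule: linorder_cases) auto
qed

lemma lower_end_at_solution:
  assumes "m \<in> A" "r \<in> A" "r < m" "d m r = c"
  shows "lower_end A d c m = ereal r"
  using divergence_function.upper_end_at_solution[OF divergence_function_reflect, of "- m" "- r" c] assms
  by (simp add: lower_end_eq_reflected_upper_end)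

lemma lower_end_zero: "m \<in> A \<Longrightarrow> lower_end A d 0 m = ereal m"
  using divergence_function.upper_end_zero[OF divergence_function_reflect, of "- m"]
  by (simp add: lower_end_eq_reflected_upper_end)

lemma ex1_left_level:
  assumes "m \<in> A" "q \<in> A" "q < m" "c \<le> d m q" "0 < c"
  shows "\<exists>!r. r \<in> A \<and> r < m \<and> d m r = c"
proof -
  let ?R = "\<lambda>r. r \<in> uminus ` A \<and> - m < r \<and> d (- (- m)) (- r) = c"
  have "\<exists>!r. ?R r"
    by (rule divergence_function.ex1_right_level[OF divergence_function_reflect, of "- m" "- q"])
      (use assms in auto)
  then obtain r where r: "?R r" and uniq: "\<forall>s. ?R s \<longrightarrow> s = r"
    by (rule ex1E)
  show ?thesis
  proof (rule ex1I[of _ "- r"])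
    show "- r \<in> A \<and> - r < m \<and> d m (- r) = c" using r by auto
    show "s = - r" if "s \<in> A \<and> s < m \<and> d m s = c" for s
      using uniq[rule_format, of "- s"] that by simp
  qed
qed

end

section \<open>Convergence in probability and tail bounds\<close>

lemma tendsto_zero_of_le:
  assumes "(g \<longlongrightarrow> (0::real)) F" "\<forall>\<^sub>F i in F. f i \<le> g i" "\<And>i. 0 \<le> f i"
  shows "(f \<longlongrightarrow> 0) F"
  using tendsto_sandwich[of "\<lambda>_. 0" f F g 0] assms by auto

text \<open>With high probability \<open>Y \<delta>\<close> lies between two fixed points around \<open>m\<close>; by monotonicity it
  suffices to control \<open>G \<delta>\<close> at these points.\<close>
lemma (in prob_space) converges_in_prob_mono_compose:
  fixes Y :: "real \<Rightarrow> 'a \<Rightarrow> real" and G :: "real \<Rightarrow> real \<Rightarrow> ereal"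
  assumes Y: "\<And>\<delta>. Y \<delta> \<in> borel_measurable M"
    and Y_left: "\<And>y. y < m \<Longrightarrow> ((\<lambda>\<delta>. prob {\<omega> \<in> space M. Y \<delta> \<omega> \<le> y}) \<longlongrightarrow> 0) (at_right 0)"
    and Y_right: "\<And>y. m < y \<Longrightarrow> ((\<lambda>\<delta>. prob {\<omega> \<in> space M. y \<le> Y \<delta> \<omega>}) \<longlongrightarrow> 0) (at_right 0)"
    and mono: "\<And>\<delta>. mono (G \<delta>)"
    and G_left: "\<And>a. a < R \<Longrightarrow> \<exists>y<m. \<forall>\<^sub>F \<delta> in at_right 0. a < G \<delta> y"
    and G_right: "\<And>a. R < a \<Longrightarrow> \<exists>y>m. \<forall>\<^sub>F \<delta> in at_right 0. G \<delta> y < a"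
  shows "converges_in_prob M (\<lambda>\<delta> \<omega>. G \<delta> (Y \<delta> \<omega>)) R"
  unfolding converges_in_prob_def
proof (intro allI impI)
  fix U :: "ereal set" assume U: "open U \<and> R \<in> U"
  note [measurable] = Y
  have "\<exists>y<m. \<forall>\<^sub>F \<delta> in at_right 0. \<forall>z. G \<delta> y \<le> z \<and> z \<le> R \<longrightarrow> z \<in> U"
  proof (cases "R = -\<infinity>")
    case True
    with U have "z \<le> R \<longrightarrow> z \<in> U" for z by auto
    then show ?thesis using lt_ex[of m] by auto
  next
    case False
    then have "-\<infinity> < R" by simp
    then obtain a where a: "a < R" "{a<..R} \<subseteq> U" using open_left[of U R "-\<infinity>"] U by blast
    obtain y where y: "y < m" "\<forall>\<^sub>F \<delta> in at_right 0. a < G \<delta> y" using G_left[OF a(1)] by blast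
    from y(2) have "\<forall>\<^sub>F \<delta> in at_right 0. \<forall>z. G \<delta> y \<le> z \<and> z \<le> R \<longrightarrow> z \<in> U"
      by eventually_elim (use a(2) in \<open>auto intro: less_le_trans\<close>)
    with y(1) show ?thesis by blast
  qed
  then obtain y1 where y1: "y1 < m"
    "\<forall>\<^sub>F \<delta> in at_right 0. \<forall>z. G \<delta> y1 \<le> z \<and> z \<le> R \<longrightarrow> z \<in> U" by blast
  have "\<exists>y>m. \<forall>\<^sub>F \<delta> in at_right 0. \<forall>z. z \<le> G \<delta> y \<and> R \<le> z \<longrightarrow> z \<in> U"
  proof (cases "R = \<infinity>")
    case True
    with U have "R \<le> z \<longrightarrow> z \<in> U" for z by auto
    then show ?thesis using gt_ex[of m] by auto
  next
    case False
    then have "R < \<infinity>" by simp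
    then obtain a where a: "R < a" "{R..<a} \<subseteq> U" using open_right[of U R "\<infinity>"] U by blast
    obtain y where y: "m < y" "\<forall>\<^sub>F \<delta> in at_right 0. G \<delta> y < a" using G_right[OF a(1)] by blast
    from y(2) have "\<forall>\<^sub>F \<delta> in at_right 0. \<forall>z. z \<le> G \<delta> y \<and> R \<le> z \<longrightarrow> z \<in> U"
      by eventually_elim (use a(2) in \<open>auto intro: le_less_trans\<close>)
    with y(1) show ?thesis by blast
  qed
  then obtain y2 where y2: "m < y2"
    "\<forall>\<^sub>F \<delta> in at_right 0. \<forall>z. z \<le> G \<delta> y2 \<and> R \<le> z \<longrightarrow> z \<in> U" by blast
  let ?L = "\<lambda>\<delta>. {\<omega> \<in> space M. Y \<delta> \<omega> \<le> y1}" and ?R = "\<lambda>\<delta>. {\<omega> \<in> space M. y2 \<le> Y \<delta> \<omega>}"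
  have lim: "((\<lambda>\<delta>. prob (?L \<delta>) + prob (?R \<delta>)) \<longlongrightarrow> 0) (at_right 0)"
    using tendsto_add[OF Y_left[OF y1(1)] Y_right[OF y2(1)]] by simp
  have "\<forall>\<^sub>F \<delta> in at_right 0.
      prob {\<omega> \<in> space M. G \<delta> (Y \<delta> \<omega>) \<notin> U} \<le> prob (?L \<delta>) + prob (?R \<delta>)"
    using y1(2) y2(2)
  proof eventually_elim
    case (elim \<delta>)
    have "G \<delta> (Y \<delta> \<omega>) \<in> U" if "y1 < Y \<delta> \<omega>" "Y \<delta> \<omega> < y2" for \<omega>
    proof (cases "G \<delta> (Y \<delta> \<omega>) \<le> R")
      case True
      have "G \<delta> y1 \<le> G \<delta> (Y \<delta> \<omega>)" using that by (intro monoD[OF mono]) auto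
      with True elim show ?thesis by blast
    next
      case False
      have "G \<delta> (Y \<delta> \<omega>) \<le> G \<delta> y2" using that by (intro monoD[OF mono]) auto
      with False elim show ?thesis by (meson nle_le)
    qed
    then have "{\<omega> \<in> space M. G \<delta> (Y \<delta> \<omega>) \<notin> U} \<subseteq> ?L \<delta> \<union> ?R \<delta>"
      by (auto simp: not_less[symmetric])
    then have "prob {\<omega> \<in> space M. G \<delta> (Y \<delta> \<omega>) \<notin> U} \<le> prob (?L \<delta> \<union> ?R \<delta>)"
      by (intro finite_measure_mono) auto
    also have "\<dots> \<le> prob (?L \<delta>) + prob (?R \<delta>)"
      by (intro measure_subadditive) auto
    finally show ?case .
  qed
  then show "((\<lambda>\<delta>. prob {\<omega> \<in> space M. G \<delta> (Y \<delta> \<omega>) \<notin> U}) \<longlongrightarrow> 0) (at_right 0)"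
    by (rule tendsto_zero_of_le[OF lim]) simp
qed

lemma converges_in_prob_uminus:
  assumes "converges_in_prob P Z c"
  shows "converges_in_prob P (\<lambda>\<delta> \<omega>. - Z \<delta> \<omega>) (- c)"
  unfolding converges_in_prob_def
proof (intro allI impI)
  fix U :: "ereal set" assume U: "open U \<and> - c \<in> U"
  have "continuous_on UNIV (uminus :: ereal \<Rightarrow> ereal)"
    by (rule continuous_uminus_ereal)
  with U have "open (uminus -` U)" "c \<in> uminus -` U" by (auto intro: open_vimage)
  with assms have "((\<lambda>\<delta>. measure P {\<omega> \<in> space P. Z \<delta> \<omega> \<notin> uminus -` U}) \<longlongrightarrow> 0) (at_right 0)"
    unfolding converges_in_prob_def by blast
  then show "((\<lambda>\<delta>. measure P {\<omega> \<in> space P. - Z \<delta> \<omega> \<notin> U}) \<longlongrightarrow> 0) (at_right 0)"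
    by simp
qed

lemma converges_in_prob_cong:
  assumes "\<forall>\<^sub>F \<delta> in at_right 0. Z \<delta> = Z' \<delta>" "converges_in_prob P Z c"
  shows "converges_in_prob P Z' c"
  unfolding converges_in_prob_def
proof (intro allI impI)
  fix U :: "ereal set" assume "open U \<and> c \<in> U"
  with assms(2) have "((\<lambda>\<delta>. measure P {\<omega> \<in> space P. Z \<delta> \<omega> \<notin> U}) \<longlongrightarrow> 0) (at_right 0)"
    unfolding converges_in_prob_def by blast
  moreover have "\<forall>\<^sub>F \<delta> in at_right 0.
      measure P {\<omega> \<in> space P. Z \<delta> \<omega> \<notin> U} = measure P {\<omega> \<in> space P. Z' \<delta> \<omega> \<notin> U}"
    using assms(1) by eventually_elim simp
  ultimately show "((\<lambda>\<delta>. measure P {\<omega> \<in> space P. Z' \<delta> \<omega> \<notin> U}) \<longlongrightarrow> 0) (at_right 0)"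
    by (rule Lim_transform_eventually)
qed

lemma (in prob_space) converges_in_prob_unique:
  assumes meas: "\<forall>\<^sub>F \<delta> in at_right 0. Z \<delta> \<in> borel_measurable M"
    and "converges_in_prob M Z a" "converges_in_prob M Z c"
  shows "a = c"
proof (rule ccontr)
  assume "a \<noteq> c"
  then obtain U V where UV: "open U" "open V" "a \<in> U" "c \<in> V" "U \<inter> V = {}"
    using hausdorff[OF \<open>a \<noteq> c\<close>] by auto
  let ?A = "\<lambda>\<delta>. {\<omega> \<in> space M. Z \<delta> \<omega> \<notin> U}" and ?B = "\<lambda>\<delta>. {\<omega> \<in> space M. Z \<delta> \<omega> \<notin> V}"
  have "((\<lambda>\<delta>. prob (?A \<delta>)) \<longlongrightarrow> 0) (at_right 0)" "((\<lambda>\<delta>. prob (?B \<delta>)) \<longlongrightarrow> 0) (at_right 0)"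
    using assms(2,3) UV unfolding converges_in_prob_def by blast+
  then have "((\<lambda>\<delta>. prob (?A \<delta>) + prob (?B \<delta>)) \<longlongrightarrow> 0 + 0) (at_right 0)"
    by (rule tendsto_add)
  then have "\<forall>\<^sub>F \<delta> in at_right 0. prob (?A \<delta>) + prob (?B \<delta>) < 1"
    by (rule order_tendstoD) simp
  with meas have "\<forall>\<^sub>F \<delta> in at_right (0::real). False"
  proof eventually_elim
    case (elim \<delta>)
    note [measurable] = elim(1)
    have [measurable]: "U \<in> sets borel" "V \<in> sets borel" using UV by auto
    have "?A \<delta> \<union> ?B \<delta> = space M" using UV(5) by auto
    then have "1 = prob (?A \<delta> \<union> ?B \<delta>)" by (simp only: prob_space)
    also have "\<dots> \<le> prob (?A \<delta>) + prob (?B \<delta>)" by (intro measure_subadditive) auto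
    finally show False using elim(2) by simp
  qed
  then show False by (simp add: eventually_False)
qed

text \<open>A down-closed set with upper bound is a half-line, closed or open. For a closed one the bound is
  immediate; an open one is reached through the left limit of the distribution function.\<close>
lemma (in prob_space) prob_mem_down_closed_le:
  fixes Y :: "'a \<Rightarrow> real"
  assumes Y[measurable]: "Y \<in> borel_measurable M"
    and down: "\<And>y z. y \<in> S \<Longrightarrow> z \<le> y \<Longrightarrow> z \<in> S" and bdd: "bdd_above S"
    and le: "\<And>y. y \<in> S \<Longrightarrow> prob {\<omega> \<in> space M. Y \<omega> \<le> y} \<le> \<epsilon>" and "0 \<le> \<epsilon>"
  shows "prob {\<omega> \<in> space M. Y \<omega> \<in> S} \<le> \<epsilon>"
proof (cases "S = {} \<or> Sup S \<in> S")
  case True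
  then consider "S = {}" | "Sup S \<in> S" by blast
  then show ?thesis
  proof cases
    case 1
    then show ?thesis using \<open>0 \<le> \<epsilon>\<close> by simp
  next
    case 2
    then have "{\<omega> \<in> space M. Y \<omega> \<in> S} = {\<omega> \<in> space M. Y \<omega> \<le> Sup S}"
      using down cSup_upper[OF _ bdd] by blast
    then show ?thesis using le[OF 2] by simp
  qed
next
  case False
  have S: "S = {..<Sup S}"
  proof (intro set_eqI iffI)
    fix x assume "x \<in> S"
    then show "x \<in> {..<Sup S}" using cSup_upper[OF _ bdd, of x] False by (cases "x = Sup S") auto
  next
    fix x assume "x \<in> {..<Sup S}"
    then obtain z where "z \<in> S" "x < z" using less_cSup_iff[of S x] False bdd by auto
    then show "x \<in> S" using down by auto
  qed
  interpret D: real_distribution "distr M borel Y"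
    by (rule real_distribution_distr) fact
  have cdf: "cdf (distr M borel Y) y = prob {\<omega> \<in> space M. Y \<omega> \<le> y}" for y
    unfolding cdf_def by (subst measure_distr) (auto intro!: arg_cong[where f=prob])
  have "measure (distr M borel Y) {..<Sup S} \<le> \<epsilon>"
  proof (rule tendsto_upperbound[OF D.cdf_at_left])
    show "\<forall>\<^sub>F y in at_left (Sup S). cdf (distr M borel Y) y \<le> \<epsilon>"
      unfolding cdf using le S by (auto simp: eventually_at_filter)
  qed simp
  also have "measure (distr M borel Y) {..<Sup S} = prob {\<omega> \<in> space M. Y \<omega> \<in> S}"
    by (subst (2) S, subst measure_distr) (auto intro!: arg_cong[where f=prob])
  finally show ?thesis .
qed

context divergence_function
begin

text \<open>A tail bound at every single point at which \<open>m\<close> is excluded yields the same bound for the event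
  that the random interval excludes \<open>m\<close> on this side, without a union bound: monotonicity of the
  endpoint makes the set of excluding points down-closed.\<close>
lemma prob_upper_end_less:
  assumes "prob_space P" and Y: "Y \<in> borel_measurable P" and m: "m \<in> A" and "0 \<le> \<epsilon>"
    and le: "\<And>y. y < m \<Longrightarrow> c < d y m \<Longrightarrow> measure P {\<omega> \<in> space P. Y \<omega> \<le> y} \<le> \<epsilon>"
  shows "measure P {\<omega> \<in> space P. upper_end A d c (Y \<omega>) < ereal m} \<le> \<epsilon>"
proof -
  interpret prob_space P by fact
  let ?S = "{y. upper_end A d c y < ereal m}"
  have "prob {\<omega> \<in> space P. Y \<omega> \<in> ?S} \<le> \<epsilon>"
  proof (rule prob_mem_down_closed_le)
    show "z \<in> ?S" if "y \<in> ?S" "z \<le> y" for y z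
      using le_less_trans[OF monoD[OF upper_end_mono that(2)]] that(1) by simp
    show "bdd_above ?S"
      using upper_end_less_imp(1)[OF m] by (intro bdd_aboveI[of _ m]) (simp add: less_imp_le)
    show "prob {\<omega> \<in> space P. Y \<omega> \<le> y} \<le> \<epsilon>" if "y \<in> ?S" for y
      using that upper_end_less_imp[OF m] by (intro le) auto
  qed fact+
  then show ?thesis by simp
qed

lemma prob_less_lower_end:
  assumes P: "prob_space P" and Y: "Y \<in> borel_measurable P" and m: "m \<in> A" and "0 \<le> \<epsilon>"
    and le: "\<And>y. m < y \<Longrightarrow> c < d y m \<Longrightarrow> measure P {\<omega> \<in> space P. y \<le> Y \<omega>} \<le> \<epsilon>"
  shows "measure P {\<omega> \<in> space P. ereal m < lower_end A d c (Y \<omega>)} \<le> \<epsilon>"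
proof -
  have "measure P {\<omega> \<in> space P. upper_end (uminus ` A) (reflect d) c (- Y \<omega>) < ereal (- m)} \<le> \<epsilon>"
  proof (rule divergence_function.prob_upper_end_less[OF divergence_function_reflect P])
    show "measure P {\<omega> \<in> space P. - Y \<omega> \<le> y} \<le> \<epsilon>" if "y < - m" "c < d (- y) (- (- m))" for y
    proof -
      have "{\<omega> \<in> space P. - Y \<omega> \<le> y} = {\<omega> \<in> space P. - y \<le> Y \<omega>}" by auto
      then show ?thesis using le[of "- y"] that by simp
    qed
  qed (use Y m \<open>0 \<le> \<epsilon>\<close> in auto)
  moreover have "ereal m < - u \<longleftrightarrow> u < ereal (- m)" for u
    by (cases u) auto
  ultimately show ?thesis
    by (simp add: lower_end_eq_reflected_upper_end)
qed

lemma converges_in_prob_upper_end: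
  assumes P: "prob_space P" and Y: "\<And>\<delta>. Y \<delta> \<in> borel_measurable P" and m: "m \<in> A"
    and Y_left: "\<And>y. y < m \<Longrightarrow> ((\<lambda>\<delta>. measure P {\<omega> \<in> space P. Y \<delta> \<omega> \<le> y}) \<longlongrightarrow> 0) (at_right 0)"
    and Y_right: "\<And>y. m < y \<Longrightarrow> ((\<lambda>\<delta>. measure P {\<omega> \<in> space P. y \<le> Y \<delta> \<omega>}) \<longlongrightarrow> 0) (at_right 0)"
    and lim: "(c' \<longlongrightarrow> c) (at_right (0::real))"
  shows "converges_in_prob P (\<lambda>\<delta> \<omega>. upper_end A d (c' \<delta>) (Y \<delta> \<omega>)) (upper_end A d c m)"
  by (rule prob_space.converges_in_prob_mono_compose[OF P Y Y_left Y_right upper_end_mono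
        eventually_less_upper_end[OF m _ lim] eventually_upper_end_less[OF m _ lim]])

lemma converges_in_prob_lower_end:
  assumes P: "prob_space P" and Y: "\<And>\<delta>. Y \<delta> \<in> borel_measurable P" and m: "m \<in> A"
    and Y_left: "\<And>y. y < m \<Longrightarrow> ((\<lambda>\<delta>. measure P {\<omega> \<in> space P. Y \<delta> \<omega> \<le> y}) \<longlongrightarrow> 0) (at_right 0)"
    and Y_right: "\<And>y. m < y \<Longrightarrow> ((\<lambda>\<delta>. measure P {\<omega> \<in> space P. y \<le> Y \<delta> \<omega>}) \<longlongrightarrow> 0) (at_right 0)"
    and lim: "(c' \<longlongrightarrow> c) (at_right (0::real))"
  shows "converges_in_prob P (\<lambda>\<delta> \<omega>. lower_end A d (c' \<delta>) (Y \<delta> \<omega>)) (lower_end A d c m)"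
proof -
  have swap: "{\<omega> \<in> space P. - Y \<delta> \<omega> \<le> y} = {\<omega> \<in> space P. - y \<le> Y \<delta> \<omega>}"
    "{\<omega> \<in> space P. y \<le> - Y \<delta> \<omega>} = {\<omega> \<in> space P. Y \<delta> \<omega> \<le> - y}" for \<delta> y
    by auto
  have "converges_in_prob P (\<lambda>\<delta> \<omega>. upper_end (uminus ` A) (reflect d) (c' \<delta>) (- Y \<delta> \<omega>))
      (upper_end (uminus ` A) (reflect d) c (- m))"
  proof (rule divergence_function.converges_in_prob_upper_end[OF divergence_function_reflect P _ _ _ _ lim])
    show "((\<lambda>\<delta>. measure P {\<omega> \<in> space P. - Y \<delta> \<omega> \<le> y}) \<longlongrightarrow> 0) (at_right 0)" if "y < - m" for y
      unfolding swap using that by (intro Y_right) simp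
    show "((\<lambda>\<delta>. measure P {\<omega> \<in> space P. y \<le> - Y \<delta> \<omega>}) \<longlongrightarrow> 0) (at_right 0)" if "- m < y" for y
      unfolding swap using that by (intro Y_left) simp
  qed (use Y m in auto)
  then show ?thesis
    unfolding lower_end_eq_reflected_upper_end by (rule converges_in_prob_uminus)
qed

end

section \<open>Chernoff's bound for the empirical mean\<close>

lemma (in prob_space) expectation_exp_pos:
  assumes "integrable M (\<lambda>x. exp (f x :: real))"
  shows "0 < expectation (\<lambda>x. exp (f x))"
proof -
  have "expectation (\<lambda>x. exp (f x)) \<noteq> 0"
  proof
    assume "expectation (\<lambda>x. exp (f x)) = 0"
    then have "AE x in M. exp (f x) = 0"
      using integral_nonneg_eq_0_iff_AE[OF assms] by simp
    then show False by simp
  qed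
  moreover have "0 \<le> expectation (\<lambda>x. exp (f x))" by simp
  ultimately show ?thesis by linarith
qed

text \<open>Jensen's inequality, obtained by integrating the tangent bound
  \<open>1 + l * (x - m) \<le> exp (l * (x - m))\<close>.\<close>
lemma mean_le_log_mgf:
  assumes "prob_space \<nu>" and int: "integrable \<nu> (\<lambda>x. x)"
  shows "ereal (l * mean \<nu>) \<le> log_mgf \<nu> l"
proof (cases "integrable \<nu> (\<lambda>x. exp (l * x))")
  case True
  interpret prob_space \<nu> by fact
  let ?m = "mean \<nu>"
  have "1 = expectation (\<lambda>x. 1 + l * (x - ?m))"
    using int by (simp add: mean_def prob_space)
  also have "\<dots> \<le> expectation (\<lambda>x. exp (l * x) * exp (- (l * ?m)))"
  proof (intro integral_mono)
    fix x show "1 + l * (x - ?m) \<le> exp (l * x) * exp (- (l * ?m))"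
      using exp_ge_add_one_self[of "l * (x - ?m)"] by (simp add: exp_add[symmetric] algebra_simps)
  qed (use int True in auto)
  also have "\<dots> = expectation (\<lambda>x. exp (l * x)) * exp (- (l * ?m))" by simp
  finally have "exp (l * ?m) \<le> expectation (\<lambda>x. exp (l * x))"
    by (simp add: exp_minus field_simps)
  then have "l * ?m \<le> ln (expectation (\<lambda>x. exp (l * x)))"
    using expectation_exp_pos[OF True] by (simp add: ln_ge_iff)
  with True show ?thesis by (simp add: log_mgf_def)
qed (simp add: log_mgf_def)

lemma prob_space_iid: "prob_space \<nu> \<Longrightarrow> prob_space (iid \<nu>)"
  unfolding iid_def by (rule prob_space_PiM)

lemma emp_mean_measurable:
  assumes "sets \<nu> = sets borel"
  shows "emp_mean n \<in> borel_measurable (iid \<nu>)"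
proof -
  have "(\<lambda>\<omega>. \<omega> t) \<in> borel_measurable (iid \<nu>)" if "t \<in> {1..n}" for t
  proof -
    have "(\<lambda>\<omega>. \<omega> t) \<in> measurable (iid \<nu>) \<nu>"
      unfolding iid_def using that by (intro measurable_component_singleton) auto
    then show ?thesis using measurable_cong_sets[OF refl assms] by blast
  qed
  then show ?thesis unfolding emp_mean_def[abs_def] by measurable
qed

lemma nn_integral_iid_prod:
  assumes "prob_space \<nu>" and g: "g \<in> borel_measurable \<nu>"
  shows "(\<integral>\<^sup>+\<omega>. (\<Prod>t=1..n. g (\<omega> t)) \<partial>iid \<nu>) = (\<integral>\<^sup>+x. g x \<partial>\<nu>) ^ n"
proof -
  interpret product_prob_space "\<lambda>_::nat. \<nu>" "{1..}"
    by (intro product_prob_spaceI) fact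
  have g': "(\<lambda>x. g (x t)) \<in> borel_measurable (PiM {1..n} (\<lambda>_. \<nu>))" if "t \<in> {1..n}" for t
    using that by (intro measurable_compose[OF _ g] measurable_component_singleton)
  have "(\<integral>\<^sup>+\<omega>. (\<Prod>t=1..n. g (\<omega> t)) \<partial>iid \<nu>)
      = (\<integral>\<^sup>+\<omega>. (\<Prod>t=1..n. g (restrict \<omega> {1..n} t)) \<partial>iid \<nu>)"
    by (intro nn_integral_cong prod.cong) auto
  also have "\<dots> = (\<integral>\<^sup>+x. (\<Prod>t=1..n. g (x t)) \<partial>distr (iid \<nu>) (PiM {1..n} (\<lambda>_. \<nu>)) (\<lambda>\<omega>. restrict \<omega> {1..n}))"
    unfolding iid_def using g'
    by (intro nn_integral_distr[symmetric] measurable_restrict_subset borel_measurable_prod_ennreal) auto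
  also have "\<dots> = (\<integral>\<^sup>+x. (\<Prod>t=1..n. g (x t)) \<partial>PiM {1..n} (\<lambda>_. \<nu>))"
    unfolding iid_def by (subst distr_PiM_restrict_finite) auto
  also have "\<dots> = (\<Prod>t=1..n. \<integral>\<^sup>+x. g x \<partial>\<nu>)"
    using g by (intro product_nn_integral_prod) auto
  finally show ?thesis by simp
qed

text \<open>Markov's inequality for \<open>exp (n * l * emp_mean n)\<close>, whose expectation factorises. Keeping the factor
  \<open>l\<close> in the event covers the upper tail (\<open>l > 0\<close>) and the lower tail (\<open>l < 0\<close>) at once.\<close>
lemma chernoff_emp_mean:
  assumes "prob_space \<nu>" and sets: "sets \<nu> = sets borel" and n: "0 < n"
    and c: "ereal c \<le> ereal (l * y) - log_mgf \<nu> l"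
  shows "measure (iid \<nu>) {\<omega> \<in> space (iid \<nu>). l * y \<le> l * emp_mean n \<omega>} \<le> exp (- (real n * c))"
proof -
  interpret prob_space \<nu> by fact
  interpret P: prob_space "iid \<nu>" by (rule prob_space_iid) fact
  have int: "integrable \<nu> (\<lambda>x. exp (l * x))"
    using c by (cases "integrable \<nu> (\<lambda>x. exp (l * x))") (auto simp: log_mgf_def)
  define E where "E = expectation (\<lambda>x. exp (l * x))"
  have E: "0 < E" unfolding E_def by (rule expectation_exp_pos[OF int])
  have c': "c \<le> l * y - ln E"
    using c int by (simp add: log_mgf_def E_def)
  let ?S = "{\<omega> \<in> space (iid \<nu>). l * y \<le> l * emp_mean n \<omega>}"
  let ?f = "\<lambda>\<omega>. \<Prod>t=1..n. ennreal (exp (l * \<omega> t))"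
  have f: "?f \<omega> = ennreal (exp (real n * (l * emp_mean n \<omega>)))" for \<omega>
    using n by (simp add: prod_ennreal exp_sum[symmetric] sum_distrib_left[symmetric] emp_mean_def)
  note [measurable] = emp_mean_measurable[OF sets]
  note [measurable_cong] = sets
  have "(\<lambda>x. ennreal (exp (l * x))) \<in> borel_measurable \<nu>"
    by measurable
  then have int_f: "(\<integral>\<^sup>+\<omega>. ?f \<omega> \<partial>iid \<nu>) = ennreal (E ^ n)"
    using E by (subst nn_integral_iid_prod[OF \<open>prob_space \<nu>\<close>])
      (simp_all add: nn_integral_eq_integral[OF int] E_def ennreal_power)
  have "ennreal (exp (- (real n * (l * y)))) * ?f \<omega>
      = ennreal (exp (real n * (l * emp_mean n \<omega> - l * y)))" for \<omega>
    unfolding f by (simp add: ennreal_mult''[symmetric] exp_add[symmetric] algebra_simps)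
  then have "?S = {\<omega> \<in> space (iid \<nu>). 1 \<le> ennreal (exp (- (real n * (l * y)))) * ?f \<omega>}"
    using n by (simp add: zero_le_mult_iff)
  moreover have "(\<lambda>\<omega>. ?f \<omega> * indicator (space (iid \<nu>)) \<omega>) \<in> borel_measurable (iid \<nu>)"
    unfolding f by measurable
  ultimately have "emeasure (iid \<nu>) ?S
      \<le> ennreal (exp (- (real n * (l * y)))) * (\<integral>\<^sup>+\<omega>. ?f \<omega> * indicator (space (iid \<nu>)) \<omega> \<partial>iid \<nu>)"
    using nn_integral_Markov_inequality[of ?f "space (iid \<nu>)" "iid \<nu>" "ennreal (exp (- (real n * (l * y))))"]
    by (simp only: sets.top simp_thms)
  also have "(\<integral>\<^sup>+\<omega>. ?f \<omega> * indicator (space (iid \<nu>)) \<omega> \<partial>iid \<nu>) = (\<integral>\<^sup>+\<omega>. ?f \<omega> \<partial>iid \<nu>)"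
    by (intro nn_integral_cong) simp
  also have "\<dots> = ennreal (E ^ n)" by (rule int_f)
  also have "E ^ n = exp (real n * ln E)"
    using E by (simp add: exp_of_nat_mult)
  also have "ennreal (exp (- (real n * (l * y)))) * ennreal (exp (real n * ln E))
      = ennreal (exp (- (real n * (l * y - ln E))))"
    by (simp add: ennreal_mult''[symmetric] exp_add[symmetric] algebra_simps)
  also have "\<dots> \<le> ennreal (exp (- (real n * c)))"
    using c' by (intro ennreal_leI) (simp add: mult_left_mono)
  finally show ?thesis
    by (simp add: P.emeasure_eq_measure)
qed

section \<open>The divergence of an exponential family\<close>

context exp_family
begin

abbreviation mean_at :: "real \<Rightarrow> real" where
  "mean_at \<theta> \<equiv> mean (family_member \<xi> b \<theta>)"

text \<open>The Bregman divergence of \<open>b\<close>; \<open>mean_at \<theta>\<close> stands in for \<open>b' \<theta>\<close>, with which it is identified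
  in \<open>deriv_b\<close>.\<close>
definition bregman :: "real \<Rightarrow> real \<Rightarrow> real" where
  "bregman \<theta> t = b t - b \<theta> - mean_at \<theta> * (t - \<theta>)"

lemma sets_family_member: "sets (family_member \<xi> b \<theta>) = sets borel"
  by (simp add: family_member_def sets_ref)

lemma Theta_between: "s \<in> Theta \<xi> \<Longrightarrow> u \<in> Theta \<xi> \<Longrightarrow> s \<le> t \<Longrightarrow> t \<le> u \<Longrightarrow> t \<in> Theta \<xi>"
  using interval_Theta unfolding is_interval_1 by blast

lemma nn_integral_exp:
  assumes "\<theta> \<in> Theta \<xi>"
  shows "(\<integral>\<^sup>+x. ennreal (exp (\<theta> * x)) \<partial>\<xi>) = ennreal (exp (b \<theta>))"
proof -
  note [measurable_cong] = sets_ref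
  interpret prob_space "family_member \<xi> b \<theta>" by (rule normalised) fact
  have "(\<integral>\<^sup>+x. ennreal (exp (\<theta> * x)) \<partial>\<xi>)
      = (\<integral>\<^sup>+x. ennreal (exp (b \<theta>)) * ennreal (exp (\<theta> * x - b \<theta>)) \<partial>\<xi>)"
    by (intro nn_integral_cong) (simp add: ennreal_mult''[symmetric] exp_add[symmetric])
  also have "\<dots> = ennreal (exp (b \<theta>)) * (\<integral>\<^sup>+x. ennreal (exp (\<theta> * x - b \<theta>)) \<partial>\<xi>)"
    by (rule nn_integral_cmult) measurable
  also have "(\<integral>\<^sup>+x. ennreal (exp (\<theta> * x - b \<theta>)) \<partial>\<xi>)
      = emeasure (family_member \<xi> b \<theta>) (space (family_member \<xi> b \<theta>))"
    unfolding family_member_def space_density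
    by (subst emeasure_density) (auto intro!: nn_integral_cong)
  also have "\<dots> = 1" by (rule emeasure_space_1)
  finally show ?thesis by simp
qed

lemma integrable_exp: "\<theta> \<in> Theta \<xi> \<Longrightarrow> integrable \<xi> (\<lambda>x. exp (\<theta> * x))"
  and integral_exp: "\<theta> \<in> Theta \<xi> \<Longrightarrow> (\<integral>x. exp (\<theta> * x) \<partial>\<xi>) = exp (b \<theta>)"
proof -
  note [measurable_cong] = sets_ref
  assume \<theta>: "\<theta> \<in> Theta \<xi>"
  show "integrable \<xi> (\<lambda>x. exp (\<theta> * x))"
    by (rule integrableI_bounded) (use nn_integral_exp[OF \<theta>] in auto)
  show "(\<integral>x. exp (\<theta> * x) \<partial>\<xi>) = exp (b \<theta>)"
    by (subst integral_eq_nn_integral) (auto simp: nn_integral_exp[OF \<theta>])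
qed

lemma integrable_family_member_iff:
  assumes "f \<in> borel_measurable borel"
  shows "integrable (family_member \<xi> b \<theta>) f \<longleftrightarrow> integrable \<xi> (\<lambda>x. exp (\<theta> * x) * f x :: real)"
proof -
  note [measurable_cong] = sets_ref
  note [measurable] = assms
  have "integrable (family_member \<xi> b \<theta>) f \<longleftrightarrow> integrable \<xi> (\<lambda>x. exp (\<theta> * x - b \<theta>) * f x)"
    unfolding family_member_def by (rule integrable_real_density) auto
  also have "(\<lambda>x. exp (\<theta> * x - b \<theta>) * f x) = (\<lambda>x. exp (- b \<theta>) * (exp (\<theta> * x) * f x))"
    by (simp add: exp_diff exp_minus field_simps)
  finally show ?thesis by simp
qed

lemma integral_family_member:
  assumes "f \<in> borel_measurable borel"
  shows "(\<integral>x. f x \<partial>family_member \<xi> b \<theta>) = exp (- b \<theta>) * (\<integral>x. exp (\<theta> * x) * f x \<partial>\<xi>)"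
proof -
  note [measurable_cong] = sets_ref
  note [measurable] = assms
  have "(\<integral>x. f x \<partial>family_member \<xi> b \<theta>) = (\<integral>x. exp (\<theta> * x - b \<theta>) * f x \<partial>\<xi>)"
    unfolding family_member_def by (rule integral_real_density) auto
  also have "(\<lambda>x. exp (\<theta> * x - b \<theta>) * f x) = (\<lambda>x. exp (- b \<theta>) * (exp (\<theta> * x) * f x))"
    by (simp add: exp_diff exp_minus field_simps)
  finally show ?thesis by simp
qed

lemma integrable_id_family_member:
  assumes "\<theta> \<in> Theta \<xi>"
  shows "integrable (family_member \<xi> b \<theta>) (\<lambda>x. x)"
proof -
  note [measurable_cong] = sets_ref
  have "integrable \<xi> (\<lambda>x. norm (exp (\<theta> * x) * x))"
    using assms by (simp add: Theta_def abs_mult mult.commute)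
  then have "integrable \<xi> (\<lambda>x. exp (\<theta> * x) * x)"
    by (rule integrable_norm_cancel) measurable
  then show ?thesis by (subst integrable_family_member_iff) auto
qed

text \<open>Besides \<open>Theta \<xi>\<close>, the exponential moments may also be finite at the endpoints of \<open>Theta \<xi>\<close>, where
  \<open>b\<close> is arbitrary; hence the formula in terms of \<open>\<xi>\<close>.\<close>
lemma log_mgf_family_member:
  assumes "\<theta> \<in> Theta \<xi>"
  shows "log_mgf (family_member \<xi> b \<theta>) l =
     (if integrable \<xi> (\<lambda>x. exp ((\<theta> + l) * x))
      then ereal (ln (\<integral>x. exp ((\<theta> + l) * x) \<partial>\<xi>) - b \<theta>) else \<infinity>)"
proof (cases "integrable \<xi> (\<lambda>x. exp ((\<theta> + l) * x))")
  case True
  have eq: "(\<lambda>x. exp (\<theta> * x) * exp (l * x)) = (\<lambda>x. exp ((\<theta> + l) * x))"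
    by (simp add: exp_add[symmetric] algebra_simps)
  have "integrable (family_member \<xi> b \<theta>) (\<lambda>x. exp (l * x))"
    using True by (subst integrable_family_member_iff) (auto simp: eq)
  moreover have "(\<integral>x. exp (l * x) \<partial>family_member \<xi> b \<theta>)
      = exp (- b \<theta>) * (\<integral>x. exp ((\<theta> + l) * x) \<partial>\<xi>)"
    by (subst integral_family_member) (auto simp: eq)
  moreover have "0 < (\<integral>x. exp (l * x) \<partial>family_member \<xi> b \<theta>)"
    by (rule prob_space.expectation_exp_pos[OF normalised[OF assms]]) fact
  ultimately show ?thesis
    using True by (simp add: log_mgf_def ln_mult zero_less_mult_iff)
next
  case False
  have eq: "(\<lambda>x. exp (\<theta> * x) * exp (l * x)) = (\<lambda>x. exp ((\<theta> + l) * x))"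
    by (simp add: exp_add[symmetric] algebra_simps)
  have "\<not> integrable (family_member \<xi> b \<theta>) (\<lambda>x. exp (l * x))"
    using False by (subst integrable_family_member_iff) (auto simp: eq)
  with False show ?thesis by (simp add: log_mgf_def)
qed

lemma log_mgf_family_member_Theta:
  "\<theta> \<in> Theta \<xi> \<Longrightarrow> \<theta> + l \<in> Theta \<xi> \<Longrightarrow>
    log_mgf (family_member \<xi> b \<theta>) l = ereal (b (\<theta> + l) - b \<theta>)"
  by (simp add: log_mgf_family_member integrable_exp integral_exp)

lemma mean_at_le_log_mgf: "\<theta> \<in> Theta \<xi> \<Longrightarrow> ereal (l * mean_at \<theta>) \<le> log_mgf (family_member \<xi> b \<theta>) l"
  by (intro mean_le_log_mgf normalised integrable_id_family_member)

text \<open>Jensen's inequality for the tilt from \<open>\<theta>\<close> to \<open>t\<close>; it says that the mean is a subgradient of \<open>b\<close>.\<close>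
lemma bregman_nonneg:
  assumes "\<theta> \<in> Theta \<xi>" "t \<in> Theta \<xi>"
  shows "0 \<le> bregman \<theta> t"
  using mean_at_le_log_mgf[OF assms(1), of "t - \<theta>"] log_mgf_family_member_Theta[of \<theta> "t - \<theta>"] assms
  by (simp add: bregman_def mult.commute)

text \<open>At the midpoint the tangent is still below \<open>b\<close>, which is strictly below the chord.\<close>
lemma bregman_pos:
  assumes \<theta>: "\<theta> \<in> Theta \<xi>" and t: "t \<in> Theta \<xi>" and "\<theta> \<noteq> t"
  shows "0 < bregman \<theta> t"
proof -
  let ?s = "(1 - 1/2) * \<theta> + (1/2) * t"
  have "b ((1 - u) * \<theta> + u * t) < (1 - u) * b \<theta> + u * b t" if "u \<in> {0<..<1}" for u
    using strictly_convex_b assms that unfolding strictly_convex_on_def by blast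
  from this[of "1/2"] have "b ?s < (1 - 1/2) * b \<theta> + (1/2) * b t" by simp
  moreover have "?s \<in> Theta \<xi>"
    using Theta_between[of \<theta> t ?s] Theta_between[of t \<theta> ?s] \<theta> t by (cases "\<theta> \<le> t") auto
  then have "0 \<le> bregman \<theta> ?s" by (rule bregman_nonneg[OF \<theta>])
  ultimately show ?thesis by (simp add: bregman_def field_simps)
qed

lemma bregman_zero [simp]: "bregman \<theta> \<theta> = 0"
  by (simp add: bregman_def)

lemma bregman_add:
  "bregman \<theta> t = bregman \<theta> s + bregman s t + (mean_at s - mean_at \<theta>) * (t - s)"
  by (simp add: bregman_def algebra_simps)

lemma mean_at_less:
  assumes "\<theta> \<in> Theta \<xi>" "t \<in> Theta \<xi>" "\<theta> < t"
  shows "mean_at \<theta> < mean_at t"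
proof -
  have "0 < bregman \<theta> t + bregman t \<theta>"
    using bregman_pos[of \<theta> t] bregman_pos[of t \<theta>] assms by simp
  also have "\<dots> = (mean_at t - mean_at \<theta>) * (t - \<theta>)"
    by (simp add: bregman_def algebra_simps)
  finally show ?thesis using assms(3) by (simp add: zero_less_mult_iff)
qed

lemma mean_at_less_iff:
  assumes "\<theta> \<in> Theta \<xi>" "t \<in> Theta \<xi>"
  shows "mean_at \<theta> < mean_at t \<longleftrightarrow> \<theta> < t" and "mean_at \<theta> \<le> mean_at t \<longleftrightarrow> \<theta> \<le> t"
  using mean_at_less[of \<theta> t] mean_at_less[of t \<theta>] assms
  by (cases \<theta> t rule: linorder_cases; force)+

lemma inj_on_mean_at: "inj_on mean_at (Theta \<xi>)"
  using mean_at_less by (intro linorder_inj_onI) force+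

lemma bregman_snd_less:
  assumes \<theta>: "\<theta> \<in> Theta \<xi>" and s: "s \<in> Theta \<xi>" and t: "t \<in> Theta \<xi>"
    and between: "\<theta> \<le> s \<and> s < t \<or> t < s \<and> s \<le> \<theta>"
  shows "bregman \<theta> s < bregman \<theta> t"
proof -
  have "0 < bregman s t" using between by (intro bregman_pos s t) auto
  moreover have "0 \<le> (mean_at s - mean_at \<theta>) * (t - s)"
    using between mean_at_less_iff[OF \<theta> s] mean_at_less_iff[OF s \<theta>]
    by (auto simp: zero_le_mult_iff)
  moreover have "bregman \<theta> t - bregman \<theta> s = bregman s t + (mean_at s - mean_at \<theta>) * (t - s)"
    using bregman_add[of \<theta> t s] by simp
  ultimately show ?thesis by linarith
qed

text \<open>\<open>b\<close> minus its supporting line at \<open>\<theta>\<close> has a minimum at \<open>\<theta>\<close>, so its derivative vanishes there.\<close>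
lemma deriv_b:
  assumes \<theta>: "\<theta> \<in> Theta \<xi>"
  shows "(b has_real_derivative mean_at \<theta>) (at \<theta>)"
proof -
  obtain D where D: "(b has_real_derivative D) (at \<theta>)"
    using differentiable_b[OF \<theta>] real_differentiable_def by blast
  obtain e where e: "0 < e" "ball \<theta> e \<subseteq> Theta \<xi>"
    using open_Theta \<theta> open_contains_ball by blast
  have "((\<lambda>t. b t - mean_at \<theta> * t) has_real_derivative D - mean_at \<theta>) (at \<theta>)"
    by (auto intro!: derivative_eq_intros D)
  moreover have "\<forall>t. \<bar>\<theta> - t\<bar> < e \<longrightarrow> b \<theta> - mean_at \<theta> * \<theta> \<le> b t - mean_at \<theta> * t"
  proof (intro allI impI)
    fix t assume "\<bar>\<theta> - t\<bar> < e"
    with e have "t \<in> Theta \<xi>" by (auto simp: dist_real_def)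
    then show "b \<theta> - mean_at \<theta> * \<theta> \<le> b t - mean_at \<theta> * t"
      using bregman_nonneg[OF \<theta>, of t] by (simp add: bregman_def algebra_simps)
  qed
  ultimately have "D - mean_at \<theta> = 0"
    by (rule DERIV_local_min[OF _ e(1)])
  with D show ?thesis by simp
qed

lemma continuous_on_b: "continuous_on (Theta \<xi>) b"
  using deriv_b by (intro continuous_at_imp_continuous_on ballI DERIV_isCont)

lemma continuous_on_mean_at: "continuous_on (Theta \<xi>) mean_at"
proof (rule continuous_on_eq)
  show "continuous_on (Theta \<xi>) (deriv b)"
    by (intro continuous_at_imp_continuous_on ballI differentiable_imp_continuous_within
        twice_differentiable_b)
  show "deriv b \<theta> = mean_at \<theta>" if "\<theta> \<in> Theta \<xi>" for \<theta>
    using deriv_b[OF that] by (rule DERIV_imp_deriv)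
qed

lemma means_eq: "means \<xi> b = mean_at ` Theta \<xi>"
  by (auto simp: means_def family_def)

lemma mean_at_mem: "\<theta> \<in> Theta \<xi> \<Longrightarrow> mean_at \<theta> \<in> means \<xi> b"
  by (simp add: means_eq)

lemma open_image_mean_at:
  assumes "open S" "S \<subseteq> Theta \<xi>"
  shows "open (mean_at ` S)"
  using injective_eq_1d_open_map_UNIV[OF continuous_on_mean_at interval_Theta] inj_on_mean_at assms
  by blast

lemma is_interval_means: "is_interval (means \<xi> b)"
  unfolding means_eq is_interval_connected_1
  using connected_continuous_image[OF continuous_on_mean_at] interval_Theta
  by (simp add: is_interval_connected_1)

lemma theta_of_mean_at: "\<theta> \<in> Theta \<xi> \<Longrightarrow> theta_of \<xi> b (mean_at \<theta>) = \<theta>"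
  unfolding theta_of_def by (rule the_inv_into_f_f[OF inj_on_mean_at])

lemma theta_of_mem: "y \<in> means \<xi> b \<Longrightarrow> theta_of \<xi> b y \<in> Theta \<xi>"
  and mean_at_theta_of: "y \<in> means \<xi> b \<Longrightarrow> mean_at (theta_of \<xi> b y) = y"
  by (auto simp: means_eq theta_of_mean_at)

lemma continuous_on_theta_of: "continuous_on (means \<xi> b) (theta_of \<xi> b)"
proof (rule continuous_on_inverse_open_map[OF continuous_on_mean_at])
  show "openin (top_of_set (means \<xi> b)) (mean_at ` S)" if "openin (top_of_set (Theta \<xi>)) S" for S
    using that open_image_mean_at open_Theta
    by (auto simp: openin_open_eq means_eq intro!: open_subset)
qed (auto simp: means_eq theta_of_mean_at)

lemma divergence_mean_at_bregman:
  assumes \<theta>: "\<theta> \<in> Theta \<xi>" and t: "t \<in> Theta \<xi>"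
  shows "divergence \<xi> b (mean_at \<theta>) (mean_at t) = ereal (bregman \<theta> t)"
proof -
  note [measurable_cong] = sets_ref sets_family_member
  let ?P = "family_member \<xi> b"
  interpret Q: prob_space "?P t" by (rule normalised[OF t])
  interpret P: prob_space "?P \<theta>" by (rule normalised[OF \<theta>])
  let ?f = "\<lambda>x. exp ((\<theta> - t) * x - (b \<theta> - b t))"
  have dens: "?P \<theta> = density (?P t) ?f"
    unfolding family_member_def
    by (subst density_density_eq)
      (auto intro!: density_cong simp: ennreal_mult''[symmetric] exp_add[symmetric] algebra_simps)
  have "KL_divergence (exp 1) (?P t) (?P \<theta>) = (\<integral>x. ?f x * log (exp 1) (?f x) \<partial>?P t)"
    unfolding dens by (rule Q.KL_density) auto
  also have "\<dots> = (\<integral>x. log (exp 1) (?f x) \<partial>?P \<theta>)"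
    unfolding dens by (rule integral_real_density[symmetric]) auto
  also have "\<dots> = (\<integral>x. (\<theta> - t) * x - (b \<theta> - b t) \<partial>?P \<theta>)"
    by (simp add: log_def)
  also have "\<dots> = (\<theta> - t) * mean_at \<theta> - (b \<theta> - b t)"
    using integrable_id_family_member[OF \<theta>] by (simp add: mean_def P.prob_space)
  also have "\<dots> = bregman \<theta> t" by (simp add: bregman_def algebra_simps)
  finally show ?thesis
    using \<theta> t by (simp add: divergence_def means_eq member_with_mean_def theta_of_mean_at)
qed

text \<open>By definition only first arguments of the form \<open>y = mean_at \<theta>\<close> are at issue. The exponent \<open>l = \<theta> - t\<close>, which tilts
  the second member into the first, attains the supremum; that no other \<open>l\<close> does better is Jensen's
  inequality under the first member.\<close>
lemma divergence_eq_SUP: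
  assumes t: "t \<in> Theta \<xi>"
  shows "divergence \<xi> b y (mean_at t) = (SUP l. ereal (l * y) - log_mgf (family_member \<xi> b t) l)"
proof (cases "y \<in> means \<xi> b")
  case True
  then obtain \<theta> where \<theta>: "\<theta> \<in> Theta \<xi>" "y = mean_at \<theta>" by (auto simp: means_eq)
  have "ereal (bregman \<theta> t) = (SUP l. ereal (l * y) - log_mgf (family_member \<xi> b t) l)"
  proof (rule antisym)
    have "ereal (bregman \<theta> t) = ereal ((\<theta> - t) * y) - log_mgf (family_member \<xi> b t) (\<theta> - t)"
      using \<theta> t log_mgf_family_member_Theta[of t "\<theta> - t"] by (simp add: bregman_def algebra_simps)
    then show "ereal (bregman \<theta> t) \<le> (SUP l. ereal (l * y) - log_mgf (family_member \<xi> b t) l)"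
      by (auto intro: SUP_upper2)
    show "(SUP l. ereal (l * y) - log_mgf (family_member \<xi> b t) l) \<le> ereal (bregman \<theta> t)"
    proof (rule SUP_least)
      fix l
      show "ereal (l * y) - log_mgf (family_member \<xi> b t) l \<le> ereal (bregman \<theta> t)"
        using mean_at_le_log_mgf[OF \<theta>(1), of "t + l - \<theta>"]
        by (auto simp: log_mgf_family_member[OF t] log_mgf_family_member[OF \<theta>(1)] \<theta>(2) bregman_def algebra_simps)
    qed
  qed
  then show ?thesis using \<theta> t by (simp add: divergence_mean_at_bregman)
next
  case False
  then show ?thesis using t by (simp add: divergence_def member_with_mean_def theta_of_mean_at)
qed

lemma divergence_nonneg:
  assumes "t \<in> Theta \<xi>"
  shows "0 \<le> divergence \<xi> b y (mean_at t)"
proof -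
  have "ereal (0 * y) - log_mgf (family_member \<xi> b t) 0 = 0"
    using log_mgf_family_member_Theta[of t 0] assms by (simp add: zero_ereal_def)
  then show ?thesis
    unfolding divergence_eq_SUP[OF assms] by (intro SUP_upper2[of 0]) auto
qed

text \<open>Term by term in the supremum: exponents \<open>l\<close> that point from the mean towards \<open>y1\<close> gain when \<open>y2\<close> is
  replaced by \<open>y1\<close>, and the others contribute at most 0 by Jensen's inequality.\<close>
lemma divergence_le_of_between:
  assumes t: "t \<in> Theta \<xi>" and y: "y1 \<le> y2 \<and> y2 \<le> mean_at t \<or> mean_at t \<le> y2 \<and> y2 \<le> y1"
  shows "divergence \<xi> b y2 (mean_at t) \<le> divergence \<xi> b y1 (mean_at t)"
  unfolding divergence_eq_SUP[OF t, of y2]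
proof (rule SUP_least)
  fix l
  let ?\<Lambda> = "log_mgf (family_member \<xi> b t) l"
  have "l * y2 \<le> l * y1 \<or> l * y2 \<le> l * mean_at t"
    using y by (cases "0 \<le> l") (auto intro: mult_left_mono mult_left_mono_neg)
  then show "ereal (l * y2) - ?\<Lambda> \<le> divergence \<xi> b y1 (mean_at t)"
  proof
    assume "l * y2 \<le> l * y1"
    then have "ereal (l * y2) - ?\<Lambda> \<le> ereal (l * y1) - ?\<Lambda>" by (intro ereal_minus_mono) auto
    also have "\<dots> \<le> divergence \<xi> b y1 (mean_at t)"
      unfolding divergence_eq_SUP[OF t] by (rule SUP_upper) simp
    finally show ?thesis .
  next
    assume "l * y2 \<le> l * mean_at t"
    then have "ereal (l * y2) \<le> ?\<Lambda>"
      using mean_at_le_log_mgf[OF t, of l] by (meson ereal_less_eq(3) order_trans)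
    then have "ereal (l * y2) - ?\<Lambda> \<le> 0" by (cases ?\<Lambda>) auto
    also have "0 \<le> divergence \<xi> b y1 (mean_at t)" by (rule divergence_nonneg[OF t])
    finally show ?thesis .
  qed
qed

lemma divergence_bregman:
  assumes "y \<in> means \<xi> b" "q \<in> means \<xi> b"
  shows "divergence \<xi> b y q = ereal (bregman (theta_of \<xi> b y) (theta_of \<xi> b q))"
  using divergence_mean_at_bregman[OF theta_of_mem theta_of_mem] assms
  by (simp add: mean_at_theta_of)

lemma divergence_function: "divergence_function (means \<xi> b) (divergence \<xi> b)"
proof
  show "open (means \<xi> b)"
    unfolding means_eq using open_image_mean_at[OF open_Theta] by simp
  show "is_interval (means \<xi> b)" by (rule is_interval_means)
  show "divergence \<xi> b q q = 0" if "q \<in> means \<xi> b" for q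
    using that by (simp add: divergence_bregman zero_ereal_def)
  show "divergence \<xi> b y2 q \<le> divergence \<xi> b y1 q"
    if "q \<in> means \<xi> b" "y1 \<le> y2" "y2 \<le> q" for q y1 y2
    using that divergence_le_of_between by (auto simp: means_eq)
  show "divergence \<xi> b y1 q \<le> divergence \<xi> b y2 q"
    if "q \<in> means \<xi> b" "q \<le> y1" "y1 \<le> y2" for q y1 y2
    using that divergence_le_of_between by (auto simp: means_eq)
  show "divergence \<xi> b y q1 < divergence \<xi> b y q2"
    if "y \<in> means \<xi> b" "q1 \<in> means \<xi> b" "q2 \<in> means \<xi> b" "y \<le> q1" "q1 < q2" for y q1 q2
    using that bregman_snd_less
    by (auto simp: means_eq divergence_mean_at_bregman mean_at_less_iff)
  show "divergence \<xi> b y q2 < divergence \<xi> b y q1"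
    if "y \<in> means \<xi> b" "q1 \<in> means \<xi> b" "q2 \<in> means \<xi> b" "q1 < q2" "q2 \<le> y" for y q1 q2
    using that bregman_snd_less
    by (auto simp: means_eq divergence_mean_at_bregman mean_at_less_iff)
  have cont_b: "continuous_on (means \<xi> b) (\<lambda>y. b (theta_of \<xi> b y))"
    by (rule continuous_on_compose2[OF continuous_on_b continuous_on_theta_of])
      (auto simp: theta_of_mem)
  show "continuous_on (means \<xi> b) (\<lambda>y. divergence \<xi> b y q)" if q: "q \<in> means \<xi> b" for q
  proof (rule continuous_on_eq)
    show "continuous_on (means \<xi> b) (\<lambda>y. ereal (b (theta_of \<xi> b q) - b (theta_of \<xi> b y)
        - y * (theta_of \<xi> b q - theta_of \<xi> b y)))"
      by (intro continuous_intros cont_b continuous_on_theta_of)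
  qed (use q in \<open>simp add: divergence_bregman bregman_def mean_at_theta_of\<close>)
  show "continuous_on (means \<xi> b) (\<lambda>q. divergence \<xi> b y q)" if y: "y \<in> means \<xi> b" for y
  proof (rule continuous_on_eq)
    show "continuous_on (means \<xi> b) (\<lambda>q. ereal (b (theta_of \<xi> b q) - b (theta_of \<xi> b y)
        - y * (theta_of \<xi> b q - theta_of \<xi> b y)))"
      by (intro continuous_intros cont_b continuous_on_theta_of)
  qed (use y in \<open>simp add: divergence_bregman bregman_def mean_at_theta_of\<close>)
qed

text \<open>For \<open>y\<close> outside the set of means, strictness is only available at a mean \<open>z\<close> between \<open>y\<close> and \<open>q\<close>, from
  where it passes to \<open>y\<close> by monotonicity.\<close>
lemma divergence_pos:
  assumes "q \<in> means \<xi> b" "y \<noteq> q"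
  shows "0 < divergence \<xi> b y q"
proof -
  interpret divergence_function "means \<xi> b" "divergence \<xi> b" by (rule divergence_function)
  obtain e where e: "0 < e" "ball q e \<subseteq> means \<xi> b"
    using open_A assms(1) open_contains_ball by blast
  define z where "z = (if y < q then max y (q - e / 2) else min y (q + e / 2))"
  have z: "z \<in> means \<xi> b" "z \<noteq> q" "y \<le> z \<and> z \<le> q \<or> q \<le> z \<and> z \<le> y"
    using e assms(2) by (auto simp: z_def dist_real_def subset_iff)
  have "0 < divergence \<xi> b z q"
    using strict_mono_snd[of z z q] strict_antimono_snd[of z q z] diag z assms(1)
    by (cases "z < q") auto
  also have "\<dots> \<le> divergence \<xi> b y q"
    using antimono_fst mono_fst assms(1) z(3) by blast
  finally show ?thesis .
qed

end

section \<open>Unbounded divergence in full families\<close>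

context exp_family
begin

text \<open>The direction \<open>v\<close> treats both sides of \<open>\<theta>\<close> at once. If the divergence stayed below \<open>C\<close>, then its
  at least linear growth would bound the admissible steps \<open>h\<close>; let \<open>S\<close> be their supremum. Along steps
  tending to \<open>S\<close> the integrals \<open>exp (b (\<theta> + v * h))\<close> stay bounded, so by Fatou's lemma the
  exponential moment at \<open>\<theta> + v * S\<close> is finite. Fullness puts \<open>\<theta> + v * S\<close> into the open set \<open>Theta \<xi>\<close>,
  and a slightly larger step is admissible: a contradiction.\<close>
lemma bregman_unbounded:
  assumes full: "full_family \<xi>" and \<theta>: "\<theta> \<in> Theta \<xi>" and v: "v \<noteq> 0"
  shows "\<exists>h>0. \<theta> + v * h \<in> Theta \<xi> \<and> C \<le> bregman \<theta> (\<theta> + v * h)"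
proof (rule ccontr)
  note [measurable_cong] = sets_ref
  assume "\<not> ?thesis"
  then have less: "bregman \<theta> (\<theta> + v * h) < C" if "0 < h" "\<theta> + v * h \<in> Theta \<xi>" for h
    using that not_le by blast
  have extend: "\<exists>e>0. \<theta> + v * (h + e) \<in> Theta \<xi>" if h: "\<theta> + v * h \<in> Theta \<xi>" for h
  proof -
    obtain e where e: "0 < e" "ball (\<theta> + v * h) e \<subseteq> Theta \<xi>"
      using open_Theta h open_contains_ball by blast
    have "\<theta> + v * (h + e / (2 * \<bar>v\<bar>)) \<in> ball (\<theta> + v * h) e"
      using e v by (simp add: dist_real_def algebra_simps abs_mult)
    with e v show ?thesis by (intro exI[of _ "e / (2 * \<bar>v\<bar>)"]) auto
  qed
  let ?T = "{h. 0 \<le> h \<and> \<theta> + v * h \<in> Theta \<xi>}"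
  obtain h1 where h1: "0 < h1" "\<theta> + v * h1 \<in> Theta \<xi>"
    using extend[of 0] \<theta> by auto
  let ?s = "\<theta> + v * h1"
  define g where "g = (mean_at ?s - mean_at \<theta>) * v"
  have g: "0 < g"
    using mean_at_less[OF \<theta> h1(2)] mean_at_less[OF h1(2) \<theta>] v h1(1)
    by (cases "0 < v") (auto simp: g_def zero_less_mult_iff mult_less_0_iff)
  have bdd: "h \<le> h1 + C / g" if "h \<in> ?T" "0 < h" for h
  proof -
    have "g * (h - h1) = (mean_at ?s - mean_at \<theta>) * ((\<theta> + v * h) - ?s)"
      by (simp add: g_def algebra_simps)
    also have "\<dots> \<le> bregman \<theta> (\<theta> + v * h)"
      using bregman_add[of \<theta> "\<theta> + v * h" ?s] bregman_nonneg[OF \<theta> h1(2)]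
        bregman_nonneg[OF h1(2), of "\<theta> + v * h"] that by simp
    also have "\<dots> < C" using that less by simp
    finally show ?thesis using g by (simp add: field_simps)
  qed
  have h1_le: "h1 \<le> h1 + C / g" using bdd[of h1] h1 by simp
  have bdd_T: "bdd_above ?T"
  proof (rule bdd_aboveI)
    fix h assume "h \<in> ?T"
    then show "h \<le> h1 + C / g" using bdd[of h] h1_le h1(1) by (cases "h = 0") auto
  qed
  have T0: "?T \<noteq> {}" using \<theta> by (auto intro!: exI[of _ 0])
  define S where "S = Sup ?T"
  have S_ge: "h \<le> S" if "h \<in> ?T" for h
    unfolding S_def using that bdd_T by (rule cSup_upper)
  have "\<exists>h\<in>?T. S - inverse (real (Suc i)) < h" for i
    using less_cSupE[OF _ T0, of "S - inverse (real (Suc i))"] unfolding S_def by auto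
  then obtain h where h: "\<And>i. h i \<in> ?T" "\<And>i. S - inverse (real (Suc i)) < h i" by metis
  have "(\<lambda>i. S - inverse (real (Suc i))) \<longlonglongrightarrow> S - 0"
    by (intro tendsto_diff tendsto_const LIMSEQ_inverse_real_of_nat)
  then have h_lim: "h \<longlonglongrightarrow> S"
    using h S_ge by (intro tendsto_sandwich[of "\<lambda>i. S - inverse (real (Suc i))" h _ "\<lambda>_. S"])
      (auto intro!: always_eventually less_imp_le)
  define B where "B = max C 0 + b \<theta> + \<bar>mean_at \<theta> * v\<bar> * S"
  have b_le: "b (\<theta> + v * h i) \<le> B" for i
  proof -
    have "bregman \<theta> (\<theta> + v * h i) \<le> max C 0"
      using less[of "h i"] h(1)[of i] by (cases "h i = 0") auto
    moreover have "mean_at \<theta> * v * h i \<le> \<bar>mean_at \<theta> * v\<bar> * S"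
      using h(1)[of i] S_ge[OF h(1)[of i]] by (intro mult_mono) auto
    ultimately show ?thesis by (simp add: bregman_def B_def algebra_simps)
  qed
  have "(\<integral>\<^sup>+x. ennreal (exp ((\<theta> + v * S) * x)) \<partial>\<xi>)
      = (\<integral>\<^sup>+x. liminf (\<lambda>i. ennreal (exp ((\<theta> + v * h i) * x))) \<partial>\<xi>)"
  proof (rule nn_integral_cong)
    fix x
    have "(\<lambda>i. ennreal (exp ((\<theta> + v * h i) * x))) \<longlonglongrightarrow> ennreal (exp ((\<theta> + v * S) * x))"
      by (intro tendsto_ennrealI tendsto_exp tendsto_mult tendsto_add tendsto_const h_lim)
    then show "ennreal (exp ((\<theta> + v * S) * x)) = liminf (\<lambda>i. ennreal (exp ((\<theta> + v * h i) * x)))"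
      by (rule lim_imp_Liminf[OF sequentially_bot, symmetric])
  qed
  also have "\<dots> \<le> liminf (\<lambda>i. \<integral>\<^sup>+x. ennreal (exp ((\<theta> + v * h i) * x)) \<partial>\<xi>)"
    by (rule nn_integral_liminf) measurable
  also have "\<dots> \<le> liminf (\<lambda>i::nat. ennreal (exp B))"
    using h(1) b_le by (intro Liminf_mono always_eventually allI) (auto simp: nn_integral_exp ennreal_leI)
  also have "\<dots> < \<infinity>" by (simp add: Liminf_const)
  finally have "integrable \<xi> (\<lambda>x. exp ((\<theta> + v * S) * x))"
    by (intro integrableI_bounded) auto
  with full have S: "\<theta> + v * S \<in> Theta \<xi>" unfolding full_family_def by blast
  obtain e where e: "0 < e" "\<theta> + v * (S + e) \<in> Theta \<xi>" using extend[OF S] by blast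
  moreover have "0 \<le> S" using S_ge[of 0] \<theta> by simp
  ultimately have "S + e \<le> S" by (intro S_ge) auto
  with e show False by simp
qed

lemma reaches_of_full_family:
  assumes full: "full_family \<xi>" and \<theta>: "\<theta> \<in> Theta \<xi>"
  shows "reaches_right \<xi> b (mean_at \<theta>) k" "reaches_left \<xi> b (mean_at \<theta>) k"
proof -
  obtain h where h: "0 < h" "\<theta> + 1 * h \<in> Theta \<xi>" "1 / k \<le> bregman \<theta> (\<theta> + 1 * h)"
    using bregman_unbounded[OF full \<theta>, of 1 "1 / k"] by auto
  then show "reaches_right \<xi> b (mean_at \<theta>) k"
    unfolding reaches_right_def using \<theta> mean_at_less
    by (intro bexI[of _ "mean_at (\<theta> + h)"]) (auto simp: divergence_mean_at_bregman mean_at_mem)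
  obtain h where h: "0 < h" "\<theta> + - 1 * h \<in> Theta \<xi>" "1 / k \<le> bregman \<theta> (\<theta> + - 1 * h)"
    using bregman_unbounded[OF full \<theta>, of "- 1" "1 / k"] by auto
  then show "reaches_left \<xi> b (mean_at \<theta>) k"
    unfolding reaches_left_def using \<theta> mean_at_less
    by (intro bexI[of _ "mean_at (\<theta> - h)"]) (auto simp: divergence_mean_at_bregman mean_at_mem)
qed

end

section \<open>Coverage and limiting endpoints of the policy\<close>

lemma ereal_mult_le_iff_le_divide:
  assumes "0 < n"
  shows "ereal (real n) * x \<le> ereal t \<longleftrightarrow> x \<le> ereal (t / real n)"
  using assms by (cases x) (auto simp: pos_le_divide_eq mult.commute)

lemma upper_pi1:
  assumes "0 < n"
  shows "upper (pi1 \<xi> b) n \<delta> x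
    = upper_end (means \<xi> b) (divergence \<xi> b) (ereal (threshold \<delta> / real n)) (emp_mean n x)"
proof -
  let ?y = "emp_mean n x" and ?C = "upper_candidates \<xi> b n \<delta> (emp_mean n x)"
  have C: "?C = {q \<in> means \<xi> b. ?y < q \<and> divergence \<xi> b ?y q \<le> ereal (threshold \<delta> / real n)}"
    using assms by (simp add: upper_candidates_def ereal_mult_le_iff_le_divide)
  have "ereal ?y \<le> (SUP q\<in>?C. ereal q)" if "?C \<noteq> {}"
  proof -
    from that obtain q where q: "q \<in> ?C" by blast
    then show ?thesis by (intro SUP_upper2[OF q]) (simp add: C)
  qed
  then have "(SUP q\<in>insert ?y ?C. ereal q)
      = (if ?C = {} then ereal ?y else (SUP q\<in>?C. ereal q))"
    by (auto simp: sup_absorb2)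
  then show ?thesis by (simp add: pi1_def Let_def upper_end_def C)
qed

lemma lower_pi1:
  assumes "0 < n"
  shows "lower (pi1 \<xi> b) n \<delta> x
    = lower_end (means \<xi> b) (divergence \<xi> b) (ereal (threshold \<delta> / real n)) (emp_mean n x)"
proof -
  let ?y = "emp_mean n x" and ?C = "lower_candidates \<xi> b n \<delta> (emp_mean n x)"
  have C: "?C = {q \<in> means \<xi> b. q < ?y \<and> divergence \<xi> b ?y q \<le> ereal (threshold \<delta> / real n)}"
    using assms by (simp add: lower_candidates_def ereal_mult_le_iff_le_divide)
  have "(INF q\<in>?C. ereal q) \<le> ereal ?y" if "?C \<noteq> {}"
  proof -
    from that obtain q where q: "q \<in> ?C" by blast
    then show ?thesis by (intro INF_lower2[OF q]) (simp add: C)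
  qed
  then have "(INF q\<in>insert ?y ?C. ereal q)
      = (if ?C = {} then ereal ?y else (INF q\<in>?C. ereal q))"
    by (auto simp: inf_absorb2)
  then show ?thesis by (simp add: pi1_def Let_def lower_end_def C)
qed

lemma emp_mean_restrict: "emp_mean n (restrict \<omega> {1..n}) = emp_mean n \<omega>"
  unfolding emp_mean_def by (intro arg_cong2[where f = "(/)"] sum.cong) auto

lemma tendsto_log_inverse_at_top: "filterlim (\<lambda>\<delta>::real. ln (1 / \<delta>)) at_top (at_right 0)"
  using filterlim_compose[OF ln_at_top filterlim_inverse_at_top_right]
  by (simp add: inverse_eq_divide)

text \<open>The threshold is \<open>ln 2 + ln (1 / \<delta>)\<close>, and the first summand is negligible. The reciprocal is taken in
  the extended reals, where \<open>inverse 0 = \<infinity>\<close> and \<open>inverse \<infinity> = 0\<close>; it is continuous on \<open>[0, \<infinity>]\<close>, so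
  the three regimes of \<open>K\<close> need no separate treatment.\<close>
lemma tendsto_threshold_div:
  fixes N :: "real \<Rightarrow> nat" and K :: ereal
  assumes "0 \<le> K"
    and K: "((\<lambda>\<delta>. ereal (real (N \<delta>) / ln (1 / \<delta>))) \<longlongrightarrow> K) (at_right 0)"
    and pos: "\<And>\<delta>. \<delta> \<in> {0<..<1} \<Longrightarrow> 0 < N \<delta>"
  shows "((\<lambda>\<delta>. ereal (threshold \<delta> / real (N \<delta>))) \<longlongrightarrow> inverse K) (at_right 0)"
proof -
  have ev: "\<forall>\<^sub>F \<delta> in at_right 0. 0 < \<delta> \<and> \<delta> < (1::real)"
    using eventually_at_right_real[of 0 "1::real"] by simp
  have "((\<lambda>\<delta>. inverse (ereal (real (N \<delta>) / ln (1 / \<delta>)))) \<longlongrightarrow> inverse K) (at_right 0)"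
  proof (rule continuous_on_tendsto_compose[OF continuous_on_inverse_ereal K])
    show "\<forall>\<^sub>F \<delta> in at_right 0. ereal (real (N \<delta>) / ln (1 / \<delta>)) \<in> {0..}"
      using ev by eventually_elim (auto intro!: divide_nonneg_nonneg)
  qed (use \<open>0 \<le> K\<close> in auto)
  moreover have "((\<lambda>\<delta>. ereal (1 + ln 2 / ln (1 / \<delta>))) \<longlongrightarrow> ereal (1 + 0)) (at_right 0)"
    by (intro tendsto_ereal tendsto_add tendsto_const
        real_tendsto_divide_at_top[OF tendsto_const tendsto_log_inverse_at_top])
  ultimately have "((\<lambda>\<delta>. ereal (1 + ln 2 / ln (1 / \<delta>)) * inverse (ereal (real (N \<delta>) / ln (1 / \<delta>))))
      \<longlongrightarrow> ereal (1 + 0) * inverse K) (at_right 0)"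
    by (intro tendsto_mult_ereal) auto
  then have "((\<lambda>\<delta>. ereal (1 + ln 2 / ln (1 / \<delta>)) * inverse (ereal (real (N \<delta>) / ln (1 / \<delta>))))
      \<longlongrightarrow> inverse K) (at_right 0)"
    by (simp flip: one_ereal_def)
  moreover have "\<forall>\<^sub>F \<delta> in at_right 0.
      ereal (1 + ln 2 / ln (1 / \<delta>)) * inverse (ereal (real (N \<delta>) / ln (1 / \<delta>)))
      = ereal (threshold \<delta> / real (N \<delta>))"
    using ev
  proof eventually_elim
    case (elim \<delta>)
    then have "0 < ln (1 / \<delta>)" "0 < N \<delta>" "threshold \<delta> = ln 2 + ln (1 / \<delta>)"
      using pos by (auto simp: threshold_def ln_div ln_mult)
    then show ?case by (simp add: field_simps)
  qed
  ultimately show ?thesis by (rule Lim_transform_eventually)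
qed

lemma tendsto_exp_neg_mult_0:
  fixes N :: "'b \<Rightarrow> nat"
  assumes "filterlim N at_top F" "0 < c"
  shows "((\<lambda>\<delta>. exp (- (real (N \<delta>) * c))) \<longlongrightarrow> 0) F"
proof -
  have "filterlim (\<lambda>\<delta>. real (N \<delta>) * c) at_top F"
    by (rule filterlim_at_top_mult_tendsto_pos[OF tendsto_const assms(2)
          filterlim_compose[OF filterlim_real_sequentially assms(1)]])
  then show ?thesis
    by (intro filterlim_compose[OF exp_at_bot] filterlim_compose[OF filterlim_uminus_at_bot_at_top])
qed

context exp_family
begin

lemma prob_space_iid_family_member: "\<theta> \<in> Theta \<xi> \<Longrightarrow> prob_space (iid (family_member \<xi> b \<theta>))"
  by (intro prob_space_iid normalised)

text \<open>An exponent \<open>l\<close> whose term in the supremum for the divergence exceeds \<open>c \<ge> 0\<close> satisfies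
  \<open>l * mean_at \<theta> < l * y\<close> by Jensen's inequality, so its sign is the one that Chernoff's bound
  requires for the tail at \<open>y\<close>.\<close>
lemma emp_mean_tails:
  fixes \<theta> c y :: real and n :: nat
  defines "P \<equiv> iid (family_member \<xi> b \<theta>)"
  assumes \<theta>: "\<theta> \<in> Theta \<xi>" and n: "0 < n" and "0 \<le> c"
    and c: "ereal c < divergence \<xi> b y (mean_at \<theta>)"
  shows "y \<le> mean_at \<theta> \<Longrightarrow> measure P {\<omega> \<in> space P. emp_mean n \<omega> \<le> y} \<le> exp (- (real n * c))"
    and "mean_at \<theta> \<le> y \<Longrightarrow> measure P {\<omega> \<in> space P. y \<le> emp_mean n \<omega>} \<le> exp (- (real n * c))"
proof -
  obtain l where l: "ereal c < ereal (l * y) - log_mgf (family_member \<xi> b \<theta>) l"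
    using c unfolding divergence_eq_SUP[OF \<theta>] less_SUP_iff by blast
  have bound: "measure P {\<omega> \<in> space P. l * y \<le> l * emp_mean n \<omega>} \<le> exp (- (real n * c))"
    unfolding P_def
    by (rule chernoff_emp_mean[OF normalised[OF \<theta>] sets_family_member n less_imp_le[OF l]])
  have "l * mean_at \<theta> < l * y"
    using mean_at_le_log_mgf[OF \<theta>, of l] l \<open>0 \<le> c\<close>
    by (cases "log_mgf (family_member \<xi> b \<theta>) l") auto
  then show "y \<le> mean_at \<theta> \<Longrightarrow> measure P {\<omega> \<in> space P. emp_mean n \<omega> \<le> y} \<le> exp (- (real n * c))"
    and "mean_at \<theta> \<le> y \<Longrightarrow> measure P {\<omega> \<in> space P. y \<le> emp_mean n \<omega>} \<le> exp (- (real n * c))"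
    using bound by (auto simp: mult_less_cancel_left mult_le_cancel_left)
qed

lemma emp_mean_weak_law:
  fixes N :: "'b \<Rightarrow> nat" and \<theta> :: real
  defines "P \<equiv> iid (family_member \<xi> b \<theta>)"
  assumes \<theta>: "\<theta> \<in> Theta \<xi>" and N: "filterlim N at_top F"
  shows "y < mean_at \<theta> \<Longrightarrow> ((\<lambda>\<delta>. measure P {\<omega> \<in> space P. emp_mean (N \<delta>) \<omega> \<le> y}) \<longlongrightarrow> 0) F"
    and "mean_at \<theta> < y \<Longrightarrow> ((\<lambda>\<delta>. measure P {\<omega> \<in> space P. y \<le> emp_mean (N \<delta>) \<omega>}) \<longlongrightarrow> 0) F"
proof -
  have ev: "\<forall>\<^sub>F \<delta> in F. 0 < N \<delta>"
    by (rule eventually_compose_filterlim[OF eventually_gt_at_top N])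
  have c: "\<exists>c>0. ereal c < divergence \<xi> b y (mean_at \<theta>)" if "y \<noteq> mean_at \<theta>"
    using ereal_dense2[OF divergence_pos[OF mean_at_mem[OF \<theta>] that]] by auto
  show "((\<lambda>\<delta>. measure P {\<omega> \<in> space P. emp_mean (N \<delta>) \<omega> \<le> y}) \<longlongrightarrow> 0) F" if y: "y < mean_at \<theta>"
  proof -
    obtain c where c: "0 < c" "ereal c < divergence \<xi> b y (mean_at \<theta>)" using c y by auto
    show ?thesis
    proof (rule tendsto_zero_of_le[OF tendsto_exp_neg_mult_0[OF N c(1)]])
      show "\<forall>\<^sub>F \<delta> in F. measure P {\<omega> \<in> space P. emp_mean (N \<delta>) \<omega> \<le> y} \<le> exp (- (real (N \<delta>) * c))"
        using ev unfolding P_def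
        by eventually_elim (use emp_mean_tails(1)[OF \<theta> _ _ c(2)] c(1) y in simp)
    qed simp
  qed
  show "((\<lambda>\<delta>. measure P {\<omega> \<in> space P. y \<le> emp_mean (N \<delta>) \<omega>}) \<longlongrightarrow> 0) F" if y: "mean_at \<theta> < y"
  proof -
    obtain c where c: "0 < c" "ereal c < divergence \<xi> b y (mean_at \<theta>)" using c y by auto
    show ?thesis
    proof (rule tendsto_zero_of_le[OF tendsto_exp_neg_mult_0[OF N c(1)]])
      show "\<forall>\<^sub>F \<delta> in F. measure P {\<omega> \<in> space P. y \<le> emp_mean (N \<delta>) \<omega>} \<le> exp (- (real (N \<delta>) * c))"
        using ev unfolding P_def
        by eventually_elim (use emp_mean_tails(2)[OF \<theta> _ _ c(2)] c(1) y in simp)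
    qed simp
  qed
qed

lemma upper_at_pi1:
  "0 < n \<Longrightarrow> upper_at (pi1 \<xi> b) n \<delta> =
     (\<lambda>\<omega>. upper_end (means \<xi> b) (divergence \<xi> b) (ereal (threshold \<delta> / real n)) (emp_mean n \<omega>))"
  and lower_at_pi1:
  "0 < n \<Longrightarrow> lower_at (pi1 \<xi> b) n \<delta> =
     (\<lambda>\<omega>. lower_end (means \<xi> b) (divergence \<xi> b) (ereal (threshold \<delta> / real n)) (emp_mean n \<omega>))"
  by (simp_all add: fun_eq_iff upper_at_def lower_at_def upper_pi1 lower_pi1 emp_mean_restrict
      del: One_nat_def)

lemma endpoints_measurable:
  assumes "0 < n"
  shows "upper_at (pi1 \<xi> b) n \<delta> \<in> borel_measurable (iid (family_member \<xi> b \<theta>))"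
    and "lower_at (pi1 \<xi> b) n \<delta> \<in> borel_measurable (iid (family_member \<xi> b \<theta>))"
proof -
  note [measurable] = emp_mean_measurable[OF sets_family_member]
    divergence_function.upper_end_measurable[OF divergence_function]
    divergence_function.lower_end_measurable[OF divergence_function]
  show "upper_at (pi1 \<xi> b) n \<delta> \<in> borel_measurable (iid (family_member \<xi> b \<theta>))"
    unfolding upper_at_pi1[OF assms] by measurable
  show "lower_at (pi1 \<xi> b) n \<delta> \<in> borel_measurable (iid (family_member \<xi> b \<theta>))"
    unfolding lower_at_pi1[OF assms] by measurable
qed

lemma is_policy_pi1: "is_policy (pi1 \<xi> b)"
  unfolding is_policy_def
proof (intro allI impI ballI conjI)
  fix n :: nat and \<delta> :: real assume "1 \<le> n"
  then have n: "0 < n" by simp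
  note [measurable] = divergence_function.upper_end_measurable[OF divergence_function]
    divergence_function.lower_end_measurable[OF divergence_function]
  have [measurable]: "emp_mean n \<in> borel_measurable (\<Pi>\<^sub>M t\<in>{1..n}. borel)"
    unfolding emp_mean_def[abs_def]
    by (intro borel_measurable_divide borel_measurable_sum measurable_component_singleton) auto
  show "lower (pi1 \<xi> b) n \<delta> \<in> borel_measurable (\<Pi>\<^sub>M t\<in>{1..n}. borel)"
    unfolding lower_pi1[OF n, abs_def] by measurable
  show "upper (pi1 \<xi> b) n \<delta> \<in> borel_measurable (\<Pi>\<^sub>M t\<in>{1..n}. borel)"
    unfolding upper_pi1[OF n, abs_def] by measurable
  show "lower (pi1 \<xi> b) n \<delta> x \<le> upper (pi1 \<xi> b) n \<delta> x" for x
    unfolding lower_pi1[OF n] upper_pi1[OF n] by (rule order_trans[OF lower_end_le upper_end_ge])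
qed

lemma coverage_pi1:
  fixes \<theta> \<delta> :: real and n :: nat
  defines "P \<equiv> iid (family_member \<xi> b \<theta>)"
  assumes \<theta>: "\<theta> \<in> Theta \<xi>" and n: "0 < n" and \<delta>: "0 < \<delta>" "\<delta> < 1"
  shows "1 - \<delta> \<le> measure P {\<omega> \<in> space P.
    ereal (mean_at \<theta>) \<in> {lower_at (pi1 \<xi> b) n \<delta> \<omega> .. upper_at (pi1 \<xi> b) n \<delta> \<omega>}}"
proof -
  let ?m = "mean_at \<theta>" and ?c = "threshold \<delta> / real n"
  interpret D: divergence_function "means \<xi> b" "divergence \<xi> b" by (rule divergence_function)
  interpret P: prob_space P unfolding P_def by (rule prob_space_iid_family_member[OF \<theta>])
  have meas: "emp_mean n \<in> borel_measurable P"
    unfolding P_def by (rule emp_mean_measurable[OF sets_family_member])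
  note [measurable] = endpoints_measurable[OF n, where \<theta> = \<theta>, folded P_def]
  (* The threshold is chosen so that Chernoff's bound is half the error level. *)
  have c: "0 \<le> ?c" "exp (- (real n * ?c)) = \<delta> / 2"
    using n \<delta> by (auto simp: threshold_def exp_minus intro!: divide_nonneg_nonneg)
  let ?U = "{\<omega> \<in> space P. upper_at (pi1 \<xi> b) n \<delta> \<omega> < ereal ?m}"
  let ?L = "{\<omega> \<in> space P. ereal ?m < lower_at (pi1 \<xi> b) n \<delta> \<omega>}"
  let ?G = "{\<omega> \<in> space P. ereal ?m \<in> {lower_at (pi1 \<xi> b) n \<delta> \<omega> .. upper_at (pi1 \<xi> b) n \<delta> \<omega>}}"
  have U: "P.prob ?U \<le> \<delta> / 2"
    unfolding upper_at_pi1[OF n]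
  proof (rule D.prob_upper_end_less[OF P.prob_space_axioms meas mean_at_mem[OF \<theta>]])
    show "P.prob {\<omega> \<in> space P. emp_mean n \<omega> \<le> y} \<le> \<delta> / 2"
      if "y < ?m" "ereal ?c < divergence \<xi> b y ?m" for y
      using emp_mean_tails(1)[OF \<theta> n c(1) that(2)] that(1) unfolding c(2) P_def by simp
  qed (use \<delta> in simp)
  have L: "P.prob ?L \<le> \<delta> / 2"
    unfolding lower_at_pi1[OF n]
  proof (rule D.prob_less_lower_end[OF P.prob_space_axioms meas mean_at_mem[OF \<theta>]])
    show "P.prob {\<omega> \<in> space P. y \<le> emp_mean n \<omega>} \<le> \<delta> / 2"
      if "?m < y" "ereal ?c < divergence \<xi> b y ?m" for y
      using emp_mean_tails(2)[OF \<theta> n c(1) that(2)] that(1) unfolding c(2) P_def by simp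
  qed (use \<delta> in simp)
  have "space P - ?G \<subseteq> ?U \<union> ?L" by auto
  then have "P.prob (space P - ?G) \<le> P.prob (?U \<union> ?L)"
    by (intro P.finite_measure_mono) auto
  also have "\<dots> \<le> P.prob ?U + P.prob ?L" by (intro measure_subadditive) auto
  also have "\<dots> \<le> \<delta>" using U L by simp
  finally have "P.prob (space P - ?G) \<le> \<delta>" .
  moreover have "P.prob (space P - ?G) = 1 - P.prob ?G"
    by (rule P.prob_compl) (auto simp: atLeastAtMost_iff)
  ultimately show ?thesis by simp
qed

lemma pi1_CI_policy: "pi1 \<xi> b \<in> CI_policies \<xi> b"
  unfolding CI_policies_def
  using is_policy_pi1 coverage_pi1 by (auto simp: family_def)

lemma limiting_endpoints_pi1:
  fixes N :: "real \<Rightarrow> nat"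
  assumes \<theta>: "\<theta> \<in> Theta \<xi>" and N: "filterlim N at_top (at_right 0)"
    and c: "((\<lambda>\<delta>. ereal (threshold \<delta> / real (N \<delta>))) \<longlongrightarrow> c) (at_right 0)"
  shows "limiting_endpoints (pi1 \<xi> b) (family_member \<xi> b \<theta>) N
    (lower_end (means \<xi> b) (divergence \<xi> b) c (mean_at \<theta>))
    (upper_end (means \<xi> b) (divergence \<xi> b) c (mean_at \<theta>))"
proof -
  interpret D: divergence_function "means \<xi> b" "divergence \<xi> b" by (rule divergence_function)
  have ev: "\<forall>\<^sub>F \<delta> in at_right 0. 0 < N \<delta>"
    by (rule eventually_compose_filterlim[OF eventually_gt_at_top N])
  note conv = prob_space_iid_family_member[OF \<theta>] emp_mean_measurable[OF sets_family_member]
    mean_at_mem[OF \<theta>] emp_mean_weak_law[OF \<theta> N] c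
  have "\<forall>\<^sub>F \<delta> in at_right 0. (\<lambda>\<omega>. upper_end (means \<xi> b) (divergence \<xi> b)
      (ereal (threshold \<delta> / real (N \<delta>))) (emp_mean (N \<delta>) \<omega>)) = upper_at (pi1 \<xi> b) (N \<delta>) \<delta>"
    using ev by eventually_elim (simp add: upper_at_pi1)
  moreover have "\<forall>\<^sub>F \<delta> in at_right 0. (\<lambda>\<omega>. lower_end (means \<xi> b) (divergence \<xi> b)
      (ereal (threshold \<delta> / real (N \<delta>))) (emp_mean (N \<delta>) \<omega>)) = lower_at (pi1 \<xi> b) (N \<delta>) \<delta>"
    using ev by eventually_elim (simp add: lower_at_pi1)
  ultimately show ?thesis
    unfolding limiting_endpoints_def
    using converges_in_prob_cong[OF _ D.converges_in_prob_upper_end[OF conv]]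
      converges_in_prob_cong[OF _ D.converges_in_prob_lower_end[OF conv]]
    by (simp add: lower_end_le upper_end_ge)
qed

lemma limiting_endpoints_unique:
  assumes \<theta>: "\<theta> \<in> Theta \<xi>" and N: "filterlim N at_top (at_right 0)"
    and "limiting_endpoints (pi1 \<xi> b) (family_member \<xi> b \<theta>) N mL mR"
    and "limiting_endpoints (pi1 \<xi> b) (family_member \<xi> b \<theta>) N mL' mR'"
  shows "mL = mL'" "mR = mR'"
proof -
  interpret P: prob_space "iid (family_member \<xi> b \<theta>)" by (rule prob_space_iid_family_member[OF \<theta>])
  have ev: "\<forall>\<^sub>F \<delta> in at_right 0. 0 < N \<delta>"
    by (rule eventually_compose_filterlim[OF eventually_gt_at_top N])
  have "\<forall>\<^sub>F \<delta> in at_right 0. upper_at (pi1 \<xi> b) (N \<delta>) \<delta> \<in> borel_measurable (iid (family_member \<xi> b \<theta>))"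
    using ev by eventually_elim (rule endpoints_measurable)
  then show "mR = mR'"
    by (rule P.converges_in_prob_unique) (use assms(3,4) in \<open>auto simp: limiting_endpoints_def\<close>)
  have "\<forall>\<^sub>F \<delta> in at_right 0. lower_at (pi1 \<xi> b) (N \<delta>) \<delta> \<in> borel_measurable (iid (family_member \<xi> b \<theta>))"
    using ev by eventually_elim (rule endpoints_measurable)
  then show "mL = mL'"
    by (rule P.converges_in_prob_unique) (use assms(3,4) in \<open>auto simp: limiting_endpoints_def\<close>)
qed

end

theorem theorem2:
  fixes \<xi> \<nu> :: "real measure" and b :: "real \<Rightarrow> real" and \<mu> :: real and N :: "real \<Rightarrow> nat"
  assumes "exp_family \<xi> b"
    and "\<nu> \<in> family \<xi> b"
    and "\<mu> = mean \<nu>"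
    and "\<And>\<delta>. \<delta> \<in> {0<..<1} \<Longrightarrow> N \<delta> > 0"
    and "filterlim N at_top (at_right 0)"
    and "\<exists>K::ereal. 0 \<le> K \<and> ((\<lambda>\<delta>. ereal (real (N \<delta>) / ln (1 / \<delta>))) \<longlongrightarrow> K) (at_right 0)"
  shows
    "pi1 \<xi> b \<in> stable_CI_policies \<xi> b \<nu> N
     \<and> (\<forall>k>0. ((\<lambda>\<delta>. real (N \<delta>) / ln (1 / \<delta>)) \<longlongrightarrow> k) (at_right 0) \<longrightarrow>
          (full_family \<xi> \<longrightarrow> reaches_right \<xi> b \<mu> k \<and> reaches_left \<xi> b \<mu> k)
          \<and> (reaches_right \<xi> b \<mu> k \<longrightarrow>
               (\<exists>!q. right_solution \<xi> b \<mu> k q)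
               \<and> (\<forall>mL mR. limiting_endpoints (pi1 \<xi> b) \<nu> N mL mR \<longrightarrow>
                     mR = ereal (THE q. right_solution \<xi> b \<mu> k q)))
          \<and> (reaches_left \<xi> b \<mu> k \<longrightarrow>
               (\<exists>!q. left_solution \<xi> b \<mu> k q)
               \<and> (\<forall>mL mR. limiting_endpoints (pi1 \<xi> b) \<nu> N mL mR \<longrightarrow>
                     mL = ereal (THE q. left_solution \<xi> b \<mu> k q))))
     \<and> (filterlim (\<lambda>\<delta>. real (N \<delta>) / ln (1 / \<delta>)) at_top (at_right 0) \<longrightarrow>
          (\<forall>mL mR. limiting_endpoints (pi1 \<xi> b) \<nu> N mL mR \<longrightarrow> mR - mL = 0))"
proof -
  interpret exp_family \<xi> b by fact
  interpret D: divergence_function "means \<xi> b" "divergence \<xi> b" by (rule divergence_function)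
  obtain \<theta> where \<theta>: "\<theta> \<in> Theta \<xi>" and \<nu>: "\<nu> = family_member \<xi> b \<theta>"
    using assms(2) by (auto simp: family_def)
  have \<mu>: "\<mu> = mean_at \<theta>" and mem: "\<mu> \<in> means \<xi> b"
    using assms(3) \<theta> \<nu> by (auto simp: mean_at_mem)
  let ?L = "\<lambda>c. lower_end (means \<xi> b) (divergence \<xi> b) c \<mu>"
  let ?U = "\<lambda>c. upper_end (means \<xi> b) (divergence \<xi> b) c \<mu>"
  have endpoints: "limiting_endpoints (pi1 \<xi> b) \<nu> N (?L (inverse K)) (?U (inverse K))"
    if "0 \<le> K" "((\<lambda>\<delta>. ereal (real (N \<delta>) / ln (1 / \<delta>))) \<longlongrightarrow> K) (at_right 0)" for K
    unfolding \<nu> \<mu>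
    by (rule limiting_endpoints_pi1[OF \<theta> assms(5) tendsto_threshold_div[OF that assms(4)]])
  have unique: "mL = ?L (inverse K)" "mR = ?U (inverse K)"
    if "0 \<le> K" "((\<lambda>\<delta>. ereal (real (N \<delta>) / ln (1 / \<delta>))) \<longlongrightarrow> K) (at_right 0)"
      "limiting_endpoints (pi1 \<xi> b) \<nu> N mL mR" for K mL mR
    using limiting_endpoints_unique[OF \<theta> assms(5), of mL mR] endpoints[OF that(1,2)] that(3)
    unfolding \<nu> by blast+
  show ?thesis
  proof (intro conjI allI impI)
    show "pi1 \<xi> b \<in> stable_CI_policies \<xi> b \<nu> N"
      unfolding stable_CI_policies_def using pi1_CI_policy endpoints assms(6) by blast
  next
    fix k :: real assume "0 < k" "full_family \<xi>"
    then show "reaches_right \<xi> b \<mu> k" "reaches_left \<xi> b \<mu> k"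
      using reaches_of_full_family[OF _ \<theta>] \<mu> by auto
  next
    fix k :: real
    assume k: "0 < k" "((\<lambda>\<delta>. real (N \<delta>) / ln (1 / \<delta>)) \<longlongrightarrow> k) (at_right 0)"
      and "reaches_right \<xi> b \<mu> k"
    then obtain q where "q \<in> means \<xi> b" "\<mu> < q" "ereal (1 / k) \<le> divergence \<xi> b \<mu> q"
      by (auto simp: reaches_right_def)
    then show ex1: "\<exists>!q. right_solution \<xi> b \<mu> k q"
      unfolding right_solution_def using k(1) by (intro D.ex1_right_level[OF mem]) auto
    fix mL mR assume "limiting_endpoints (pi1 \<xi> b) \<nu> N mL mR"
    then have "mR = ?U (ereal (1 / k))"
      using unique(2)[of "ereal k" mL mR] k by (simp add: inverse_eq_divide)
    also have "\<dots> = ereal (THE q. right_solution \<xi> b \<mu> k q)"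
      using theI'[OF ex1] by (intro D.upper_end_at_solution[OF mem]) (auto simp: right_solution_def)
    finally show "mR = ereal (THE q. right_solution \<xi> b \<mu> k q)" .
  next
    fix k :: real
    assume k: "0 < k" "((\<lambda>\<delta>. real (N \<delta>) / ln (1 / \<delta>)) \<longlongrightarrow> k) (at_right 0)"
      and "reaches_left \<xi> b \<mu> k"
    then obtain q where "q \<in> means \<xi> b" "q < \<mu>" "ereal (1 / k) \<le> divergence \<xi> b \<mu> q"
      by (auto simp: reaches_left_def)
    then show ex1: "\<exists>!q. left_solution \<xi> b \<mu> k q"
      unfolding left_solution_def using k(1) by (intro D.ex1_left_level[OF mem]) auto
    fix mL mR assume "limiting_endpoints (pi1 \<xi> b) \<nu> N mL mR"
    then have "mL = ?L (ereal (1 / k))"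
      using unique(1)[of "ereal k" mL mR] k by (simp add: inverse_eq_divide)
    also have "\<dots> = ereal (THE q. left_solution \<xi> b \<mu> k q)"
      using theI'[OF ex1] by (intro D.lower_end_at_solution[OF mem]) (auto simp: left_solution_def)
    finally show "mL = ereal (THE q. left_solution \<xi> b \<mu> k q)" .
  next
    assume "filterlim (\<lambda>\<delta>. real (N \<delta>) / ln (1 / \<delta>)) at_top (at_right 0)"
    then have lim: "((\<lambda>\<delta>. ereal (real (N \<delta>) / ln (1 / \<delta>))) \<longlongrightarrow> \<infinity>) (at_right 0)"
      by (simp add: tendsto_PInfty filterlim_at_top_dense)
    fix mL mR assume "limiting_endpoints (pi1 \<xi> b) \<nu> N mL mR"
    then have "mL = ereal \<mu>" "mR = ereal \<mu>"
      using unique[OF _ lim, of mL mR] D.lower_end_zero[OF mem] D.upper_end_zero[OF mem] by auto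
    then show "mR - mL = 0" by (simp add: zero_ereal_def)
  qed
qed

end
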